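(* For all integers $N,d\ge 2$, \[ \sup_{\rho\in \mathrm{BOS}_N^{(2)}(d)}\ \inf_{\tau\in \mathrm{SEP}_{\mathrm H}^{(2)}(d)}\ \|\rho-\tau\|_2\ \le\ \min\left\{\frac{\sqrt{d-1}}{N-1},\ \frac{8}{\sqrt{N-1}}\right\}. \] (In particular, for each fixed $d$ the first term gives the rate $O(\sqrt d/N)$.)
   Context: $\mathrm D(\mathcal H)$ denotes the density operators on a finite-dimensional complex Hilbert space $\mathcal H$, and $\|X\|_2=\sqrt{\mathrm{Tr}(X^\dagger X)}$ is the Hilbert--Schmidt norm. $\mathrm{Sym}^N(\mathbb C^d)\subseteq(\mathbb C^d)^{\otimes N}$ is the symmetric subspace. For a state $\rho_N$ on $(\mathbb C^d)^{\otimes N}$, $\rho_N^{(2)}$ is its marginal on the first two tensor factors. $\mathrm{BOS}_N^{(2)}(d):=\{\rho_N^{(2)}:\rho_N\in\mathrm D(\mathrm{Sym}^N(\mathbb C^d))\}$. $\mathrm{SEP}_{\mathrm H}^{(2)}(d):=\mathrm{conv}\{(|u\rangle\langle u|)^{\otimes 2}:u\in\mathbb C^d,\ \|u\|=1\}$. *)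

theory Defs
  imports "HOL-Analysis.Analysis" "HOL-Combinatorics.Permutations"
begin

text \<open>
  The space \<open>\<complex>\<^sup>d\<close> is \<^typ>\<open>complex ^ 'd\<close> with \<open>d = CARD('d)\<close>.  The standard basis of its
  \<open>N\<close>-fold tensor power is indexed by the lists over \<^typ>\<open>'d\<close> of length \<open>N\<close>, the \<open>i\<close>-th entry
  belonging to the \<open>i\<close>-th tensor factor.  Vectors and operators are coordinate functions and
  matrices on such lists, with value 0 at lists of any other length.
\<close>

definition tensor_space :: "nat \<Rightarrow> ('d list \<Rightarrow> complex) set" where
  "tensor_space N = {\<psi>. \<forall>xs. length xs \<noteq> N \<longrightarrow> \<psi> xs = 0}"

definition tensor_ops :: "nat \<Rightarrow> ('d list \<Rightarrow> 'd list \<Rightarrow> complex) set" where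
  "tensor_ops N = {A. \<forall>xs ys. length xs \<noteq> N \<or> length ys \<noteq> N \<longrightarrow> A xs ys = 0}"

definition tensor_inner ::
    "nat \<Rightarrow> ('d::finite list \<Rightarrow> complex) \<Rightarrow> ('d list \<Rightarrow> complex) \<Rightarrow> complex" where
  "tensor_inner N \<phi> \<psi> = (\<Sum>xs | length xs = N. cnj (\<phi> xs) * \<psi> xs)"

definition tensor_apply ::
    "nat \<Rightarrow> ('d::finite list \<Rightarrow> 'd list \<Rightarrow> complex) \<Rightarrow> ('d list \<Rightarrow> complex) \<Rightarrow> ('d list \<Rightarrow> complex)" where
  "tensor_apply N A \<psi> = (\<lambda>xs. \<Sum>ys | length ys = N. A xs ys * \<psi> ys)"

definition tensor_trace :: "nat \<Rightarrow> ('d::finite list \<Rightarrow> 'd list \<Rightarrow> complex) \<Rightarrow> complex" where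
  "tensor_trace N A = (\<Sum>xs | length xs = N. A xs xs)"

definition density_ops :: "nat \<Rightarrow> ('d::finite list \<Rightarrow> 'd list \<Rightarrow> complex) set" where
  "density_ops N = {\<rho> \<in> tensor_ops N.
     (\<forall>xs ys. \<rho> ys xs = cnj (\<rho> xs ys)) \<and>
     (\<forall>\<psi> \<in> tensor_space N. 0 \<le> Re (tensor_inner N \<psi> (tensor_apply N \<rho> \<psi>))) \<and>
     tensor_trace N \<rho> = 1}"

definition sym_space :: "nat \<Rightarrow> ('d list \<Rightarrow> complex) set" where
  "sym_space N = {\<psi> \<in> tensor_space N.
     \<forall>p xs. p permutes {..<N} \<and> length xs = N \<longrightarrow> \<psi> (permute_list p xs) = \<psi> xs}"

text \<open>
  A density operator on the symmetric subspace is identified with its extension by 0 to the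
  orthogonal complement, that is, with a density operator on the full tensor power whose range
  is contained in the symmetric subspace.
\<close>

definition sym_density_ops :: "nat \<Rightarrow> ('d::finite list \<Rightarrow> 'd list \<Rightarrow> complex) set" where
  "sym_density_ops N =
     {\<rho> \<in> density_ops N. \<forall>\<psi> \<in> tensor_space N. tensor_apply N \<rho> \<psi> \<in> sym_space N}"

text \<open>
  Operators on \<open>\<complex>\<^sup>d \<otimes> \<complex>\<^sup>d\<close> are matrices indexed by pairs.  The marginal on the first two
  factors is the partial trace over the remaining \<open>N - 2\<close> ones; it is meaningful for \<open>N \<ge> 2\<close>.
\<close>

definition marginal2 ::
    "nat \<Rightarrow> ('d::finite list \<Rightarrow> 'd list \<Rightarrow> complex) \<Rightarrow> complex ^ ('d \<times> 'd) ^ ('d \<times> 'd)" where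
  "marginal2 N \<rho> = (\<chi> i j. \<Sum>zs | length zs = N - 2.
     \<rho> (fst i # snd i # zs) (fst j # snd j # zs))"

definition BOS2 :: "nat \<Rightarrow> (complex ^ ('d::finite \<times> 'd) ^ ('d \<times> 'd)) set" where
  "BOS2 N = marginal2 N ` sym_density_ops N"

definition ket_bra :: "complex ^ 'n \<Rightarrow> complex ^ 'n ^ 'n" where
  "ket_bra u = (\<chi> i j. u $ i * cnj (u $ j))"

definition kronecker ::
    "complex ^ 'm ^ 'm \<Rightarrow> complex ^ 'n ^ 'n \<Rightarrow> complex ^ ('m::finite \<times> 'n::finite) ^ ('m \<times> 'n)" where
  "kronecker A B = (\<chi> i j. A $ fst i $ fst j * B $ snd i $ snd j)"

definition SEP2 :: "(complex ^ ('d::finite \<times> 'd) ^ ('d \<times> 'd)) set" where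
  "SEP2 = convex hull {kronecker (ket_bra u) (ket_bra u) | u. norm u = 1}"

definition conj_transpose :: "complex ^ 'n ^ 'm \<Rightarrow> complex ^ 'm ^ 'n" where
  "conj_transpose A = (\<chi> i j. cnj (A $ j $ i))"

definition hs_norm :: "complex ^ 'n ^ 'n \<Rightarrow> real" where
  "hs_norm A = sqrt (Re (trace (conj_transpose A ** A)))"

lemma hs_norm_eq_norm: "hs_norm A = norm A"
proof -
  have "Re (trace (conj_transpose A ** A)) = (\<Sum>i\<in>UNIV. \<Sum>k\<in>UNIV. (cmod (A $ k $ i))\<^sup>2)"
    unfolding trace_def matrix_matrix_mult_def conj_transpose_def cmod_power2
    by (simp add: power2_eq_square)
  also have "\<dots> = (\<Sum>k\<in>UNIV. (norm (A $ k))\<^sup>2)"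
    by (subst sum.swap) (simp add: norm_vec_def L2_set_def sum_nonneg)
  finally show ?thesis
    by (simp add: hs_norm_def norm_vec_def[of A] L2_set_def)
qed

end

theory Submission imports Defs begin

text \<open>
  Let \<open>\<tau>\<close> be the point of \<open>SEP2\<close> closest to the marginal \<open>\<rho>\<close> and \<open>W = \<rho> - \<tau>\<close>. Then
  \<open>\<parallel>W\<parallel>\<^sup>2 = \<langle>W, \<rho>\<rangle> - \<langle>W, \<tau>\<rangle>\<close>, and \<open>\<langle>W, \<tau>\<rangle>\<close> dominates the Hartree values
  \<open>\<langle>u \<otimes> u, W (u \<otimes> u)\<rangle>\<close> of all unit vectors \<open>u\<close>. So it suffices to bound the two-body energy of
  a bosonic \<open>N\<close>-body state by the Hartree maximum plus the error term times \<open>\<parallel>W\<parallel>\<close>.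

  Let \<open>\<psi>\<close> be a bosonic state of maximal energy, hence an eigenvector, and let \<open>u\<close> maximise
  \<open>c = \<bar>\<langle>u\<^sup>\<otimes>\<^sup>N, \<psi>\<rangle>\<bar>\<close>. The first and second order conditions say that contracting \<open>N - 2\<close> factors of
  \<open>\<psi>\<close> with \<open>u\<close> gives \<open>c (u \<otimes> u)\<close> plus a symmetric tensor on the complement of \<open>u\<close> whose
  operator norm is at most \<open>c / (N - 1)\<close>. Pairing the eigenvalue equation with \<open>u\<^sup>\<otimes>\<^sup>N\<close> gives the first
  bound. If \<open>W\<close> acts on \<open>P \<otimes> P\<close> with \<open>rank P = k\<close>, the same argument gives the error
  \<open>\<surd>k / (N - 1)\<close>.

  For the second bound take \<open>P\<close> spanned by at most \<open>N - 1\<close> orthonormal directions of occupation above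
  \<open>1 / (N - 1)\<close>. On the complement the occupations are small, and replacing \<open>W\<close> by its
  compression to \<open>P \<otimes> P\<close> changes the energy by \<open>O(\<parallel>W\<parallel> / \<surd>(N - 1))\<close>.
\<close>

subsection \<open>Finite-dimensional linear algebra over coordinate functions\<close>

text \<open>The index set is an argument, so tensors of every length live in one function type and
  only their values on \<open>S\<close> count. The form is antilinear in its first slot.\<close>

definition ip :: "'i set \<Rightarrow> ('i \<Rightarrow> complex) \<Rightarrow> ('i \<Rightarrow> complex) \<Rightarrow> complex" where
  "ip S f g = (\<Sum>i\<in>S. cnj (f i) * g i)"

definition nsq :: "'i set \<Rightarrow> ('i \<Rightarrow> complex) \<Rightarrow> real" where
  "nsq S f = (\<Sum>i\<in>S. (cmod (f i))\<^sup>2)"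

lemma nsq_nonneg [simp]: "0 \<le> nsq S f"
  by (simp add: nsq_def sum_nonneg)

lemma ip_self: "ip S f f = of_real (nsq S f)"
  by (simp add: ip_def nsq_def complex_norm_square mult.commute del: of_real_power)

lemma cnj_ip: "cnj (ip S f g) = ip S g f"
  by (simp add: ip_def mult.commute)

lemma ip_add_right: "ip S f (\<lambda>i. g i + h i) = ip S f g + ip S f h"
  by (simp add: ip_def distrib_left sum.distrib)

lemma ip_diff_right: "ip S f (\<lambda>i. g i - h i) = ip S f g - ip S f h"
  by (simp add: ip_def right_diff_distrib sum_subtractf)

lemma ip_scale_right: "ip S f (\<lambda>i. c * g i) = c * ip S f g"
  by (simp add: ip_def sum_distrib_left mult_ac)

lemma ip_sum_right: "ip S f (\<lambda>i. \<Sum>j\<in>J. g j i) = (\<Sum>j\<in>J. ip S f (g j))"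
  unfolding ip_def by (simp add: sum_distrib_left) (rule sum.swap)

lemma nsq_scale: "nsq S (\<lambda>i. c * f i) = (cmod c)\<^sup>2 * nsq S f"
  by (simp add: nsq_def norm_mult power_mult_distrib sum_distrib_left)

lemma nsq_eq_0_iff: "finite S \<Longrightarrow> nsq S f = 0 \<longleftrightarrow> (\<forall>i\<in>S. f i = 0)"
  unfolding nsq_def by (subst sum_nonneg_eq_0_iff) auto

lemma nsq_diff: "nsq S (\<lambda>i. f i - g i) = nsq S f - 2 * Re (ip S f g) + nsq S g"
proof -
  have "(cmod (a - b))\<^sup>2 = (cmod a)\<^sup>2 - 2 * Re (cnj a * b) + (cmod b)\<^sup>2" for a b
    unfolding cmod_power2 by (simp add: power2_eq_square algebra_simps)
  then show ?thesis
    by (simp add: nsq_def ip_def sum.distrib sum_subtractf sum_distrib_left)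
qed

lemma ip_scale_left: "ip S (\<lambda>i. c * f i) g = cnj c * ip S f g"
  by (simp add: ip_def sum_distrib_left mult_ac)

lemma nsq_add: "nsq S (\<lambda>i. f i + g i) = nsq S f + 2 * Re (ip S f g) + nsq S g"
proof -
  have "(cmod (a + b))\<^sup>2 = (cmod a)\<^sup>2 + 2 * Re (cnj a * b) + (cmod b)\<^sup>2" for a b
    unfolding cmod_power2 by (simp add: power2_eq_square algebra_simps)
  then show ?thesis
    by (simp add: nsq_def ip_def sum.distrib sum_distrib_left)
qed

lemma nsq_cong: "(\<And>x. x \<in> S \<Longrightarrow> f x = g x) \<Longrightarrow> nsq S f = nsq S g"
  by (simp add: nsq_def cong: sum.cong)

lemma cauchy_schwarz: "cmod (ip S f g) \<le> sqrt (nsq S f) * sqrt (nsq S g)"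
proof -
  have "cmod (ip S f g) \<le> (\<Sum>i\<in>S. \<bar>cmod (f i)\<bar> * \<bar>cmod (g i)\<bar>)"
    unfolding ip_def by (rule order_trans[OF norm_sum]) (simp add: norm_mult)
  also have "\<dots> \<le> sqrt (nsq S f) * sqrt (nsq S g)"
    using L2_set_mult_ineq[of "\<lambda>i. cmod (f i)" "\<lambda>i. cmod (g i)" S]
    by (simp add: L2_set_def nsq_def)
  finally show ?thesis .
qed

lemma cauchy_schwarz_sq: "(cmod (ip S f g))\<^sup>2 \<le> nsq S f * nsq S g"
  using power_mono[OF cauchy_schwarz[of S f g] norm_ge_zero, of 2] by (simp add: power_mult_distrib)

text \<open>Cauchy-Schwarz in the shape in which bounds for single rows or directions, each a
  product of two square roots, are added up.\<close>

lemma sum_mult_le_sqrt: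
  fixes f g :: "'i \<Rightarrow> real"
  assumes "\<And>i. i \<in> S \<Longrightarrow> 0 \<le> f i" "\<And>i. i \<in> S \<Longrightarrow> 0 \<le> g i"
  shows "(\<Sum>i\<in>S. sqrt (f i) * sqrt (g i)) \<le> sqrt (\<Sum>i\<in>S. f i) * sqrt (\<Sum>i\<in>S. g i)"
proof -
  have "(\<Sum>i\<in>S. sqrt (f i) * sqrt (g i)) = (\<Sum>i\<in>S. \<bar>sqrt (f i)\<bar> * \<bar>sqrt (g i)\<bar>)"
    using assms by (intro sum.cong) auto
  also have "\<dots> \<le> L2_set (\<lambda>i. sqrt (f i)) S * L2_set (\<lambda>i. sqrt (g i)) S"
    by (rule L2_set_mult_ineq)
  also have "\<dots> = sqrt (\<Sum>i\<in>S. f i) * sqrt (\<Sum>i\<in>S. g i)"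
    using assms by (simp add: L2_set_def)
  finally show ?thesis .
qed

lemma sum_pairs: "(\<Sum>a\<in>A. \<Sum>b\<in>B. g a b) = (\<Sum>p\<in>A \<times> B. g (fst p) (snd p))"
  by (simp add: sum.cartesian_product case_prod_unfold)

lemma sum_swap_pairs:
  "(\<Sum>a\<in>A. \<Sum>b\<in>B. \<Sum>c\<in>C. \<Sum>d\<in>D. f a b c d) = (\<Sum>c\<in>C. \<Sum>d\<in>D. \<Sum>a\<in>A. \<Sum>b\<in>B. f a b c d)"
  unfolding sum_pairs[of _ B A] sum_pairs[of _ D C] by (rule sum.swap)

lemma sum_rotate:
  "(\<Sum>a\<in>A. \<Sum>b\<in>B. \<Sum>c\<in>C. \<Sum>d\<in>D. f a b c d) = (\<Sum>b\<in>B. \<Sum>c\<in>C. \<Sum>d\<in>D. \<Sum>a\<in>A. f a b c d)"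
  by (subst sum.swap, intro sum.cong refl, subst sum.swap, intro sum.cong refl) (rule sum.swap)

lemma sum_Times: "(\<Sum>p\<in>A \<times> B. G p) = (\<Sum>a\<in>A. \<Sum>b\<in>B. G (a, b))"
  by (simp add: sum_pairs)

section \<open>Orthonormal systems, projections and Bessel's inequality\<close>

definition onsys :: "nat \<Rightarrow> (nat \<Rightarrow> 'd::finite \<Rightarrow> complex) \<Rightarrow> bool" where
  "onsys k p \<longleftrightarrow> (\<forall>i<k. \<forall>j<k. ip UNIV (p i) (p j) = (if i = j then 1 else 0))"

definition proj :: "nat \<Rightarrow> (nat \<Rightarrow> 'd::finite \<Rightarrow> complex) \<Rightarrow> ('d \<Rightarrow> complex) \<Rightarrow> 'd \<Rightarrow> complex" where
  "proj k p f = (\<lambda>x. \<Sum>i<k. ip UNIV (p i) f * p i x)"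

lemma ip_onsys_proj:
  assumes "onsys k p" "i < k"
  shows "ip UNIV (p i) (proj k p f) = ip UNIV (p i) f"
proof -
  have "ip UNIV (p i) (proj k p f) = (\<Sum>j<k. ip UNIV (p j) f * ip UNIV (p i) (p j))"
    by (simp add: proj_def ip_sum_right ip_scale_right)
  also have "\<dots> = (\<Sum>j<k. if j = i then ip UNIV (p i) f else 0)"
    using assms by (intro sum.cong) (auto simp: onsys_def)
  finally show ?thesis
    using assms by simp
qed

lemma ip_proj_right: "ip UNIV g (proj k p f) = (\<Sum>i<k. ip UNIV (p i) f * ip UNIV g (p i))"
  by (simp add: proj_def ip_sum_right ip_scale_right)

lemma ip_proj_left: "ip UNIV (proj k p f) g = ip UNIV f (proj k p g)"
proof -
  have "ip UNIV (proj k p f) g = cnj (ip UNIV g (proj k p f))"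
    by (simp add: cnj_ip)
  also have "\<dots> = ip UNIV f (proj k p g)"
    by (simp add: ip_proj_right cnj_ip mult.commute)
  finally show ?thesis .
qed

lemma proj_proj:
  assumes "onsys k p"
  shows "proj k p (proj k p f) = proj k p f"
proof
  fix x
  have "proj k p (proj k p f) x = (\<Sum>i<k. ip UNIV (p i) (proj k p f) * p i x)"
    by (simp only: proj_def)
  also have "\<dots> = (\<Sum>i<k. ip UNIV (p i) f * p i x)"
    using ip_onsys_proj[OF assms] by (intro sum.cong) auto
  finally show "proj k p (proj k p f) x = proj k p f x"
    by (simp only: proj_def)
qed

lemma proj_cnj: "proj k (\<lambda>i x. cnj (p i x)) (\<lambda>x. cnj (f x)) = (\<lambda>x. cnj (proj k p f x))"
  by (simp add: proj_def ip_def)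

lemma nsq_proj:
  assumes "onsys k p"
  shows "nsq UNIV (proj k p f) = (\<Sum>i<k. (cmod (ip UNIV (p i) f))\<^sup>2)"
proof -
  have "ip UNIV (proj k p f) (p i) = cnj (ip UNIV (p i) f)" if "i < k" for i
    using ip_onsys_proj[OF assms that] cnj_ip by metis
  then have "of_real (nsq UNIV (proj k p f)) = (\<Sum>i<k. of_real ((cmod (ip UNIV (p i) f))\<^sup>2) :: complex)"
    by (simp add: ip_self[symmetric] ip_proj_right complex_norm_square del: of_real_power)
  then show ?thesis
    by (metis of_real_eq_iff of_real_sum)
qed

lemma nsq_minus_proj:
  assumes "onsys k p"
  shows "nsq UNIV (\<lambda>x. f x - proj k p f x) = nsq UNIV f - nsq UNIV (proj k p f)"
proof -
  have "ip UNIV f (proj k p f) = (\<Sum>i<k. of_real ((cmod (ip UNIV (p i) f))\<^sup>2))"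
    by (simp add: ip_proj_right complex_norm_square cnj_ip del: of_real_power)
  then have "Re (ip UNIV f (proj k p f)) = nsq UNIV (proj k p f)"
    by (simp add: nsq_proj[OF assms])
  then show ?thesis
    by (simp add: nsq_diff)
qed

lemma bessel:
  assumes "onsys k p"
  shows "(\<Sum>i<k. (cmod (ip UNIV (p i) f))\<^sup>2) \<le> nsq UNIV f"
  using nsq_minus_proj[OF assms, of f] nsq_nonneg[of UNIV "\<lambda>x. f x - proj k p f x"]
  by (simp add: nsq_proj[OF assms])

text \<open>Bessel's inequality at each \<open>r\<close>, summed over \<open>r\<close>. For a tensor
  \<open>\<phi>\<close> with its first factor singled out, the occupations of orthonormal directions
  add up to at most its squared norm.\<close>

lemma bessel_family:
  assumes "onsys k p"
  shows "(\<Sum>i<k. nsq S (\<lambda>r. ip UNIV (p i) (\<lambda>x. \<phi> x r))) \<le> (\<Sum>x\<in>UNIV. nsq S (\<phi> x))"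
proof -
  have "(\<Sum>i<k. nsq S (\<lambda>r. ip UNIV (p i) (\<lambda>x. \<phi> x r)))
      = (\<Sum>r\<in>S. \<Sum>i<k. (cmod (ip UNIV (p i) (\<lambda>x. \<phi> x r)))\<^sup>2)"
    unfolding nsq_def by (rule sum.swap)
  also have "\<dots> \<le> (\<Sum>r\<in>S. nsq UNIV (\<lambda>x. \<phi> x r))"
    by (intro sum_mono bessel assms)
  also have "\<dots> = (\<Sum>x\<in>UNIV. nsq S (\<phi> x))"
    unfolding nsq_def by (rule sum.swap)
  finally show ?thesis .
qed

text \<open>
  A greedy choice of directions in which the quadratic form exceeds \<open>t\<close> replaces the spectral
  projection onto its eigenvalues above \<open>t\<close>.
\<close>

lemma greedy_onsys:
  fixes \<phi> :: "'d::finite \<Rightarrow> 'r \<Rightarrow> complex"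
  assumes "0 < t"
  obtains k p where "onsys k p" "real k * t \<le> (\<Sum>x\<in>UNIV. nsq S (\<phi> x))"
    "\<And>q. (\<And>i. i < k \<Longrightarrow> ip UNIV (p i) q = 0)
        \<Longrightarrow> nsq S (\<lambda>r. ip UNIV q (\<lambda>x. \<phi> x r)) \<le> t * nsq UNIV q"
proof -
  define G where "G q = nsq S (\<lambda>r. ip UNIV q (\<lambda>x. \<phi> x r))" for q
  define C where "C = (\<Sum>x\<in>UNIV. nsq S (\<phi> x))"
  define good where "good k p \<longleftrightarrow> onsys k p \<and> (\<forall>i<k. t \<le> G (p i))" for k p
  have bound: "real k * t \<le> C" if "good k p" for k p
  proof -
    have "real k * t = (\<Sum>i<k. t)" by simp
    also have "\<dots> \<le> (\<Sum>i<k. G (p i))"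
      using that by (intro sum_mono) (auto simp: good_def)
    also have "\<dots> \<le> C"
      using that bessel_family[of k p S \<phi>] by (simp add: good_def G_def C_def)
    finally show ?thesis .
  qed
  have bd: "k \<le> nat \<lceil>C / t\<rceil>" if "\<exists>p. good k p" for k
  proof -
    have "real k \<le> C / t"
      using that bound assms by (auto simp: field_simps)
    then show ?thesis by linarith
  qed
  have "\<exists>p. good 0 p"
    by (simp add: good_def onsys_def)
  \<comment> \<open>A good system of greatest length exists because \<open>bd\<close> caps the
    length.\<close>
  then obtain k where k: "\<exists>p. good k p" "\<And>l. (\<exists>p. good l p) \<Longrightarrow> l \<le> k"
    using bd GreatestI_nat[of "\<lambda>k. \<exists>p. good k p" 0] Greatest_le_nat[of "\<lambda>k. \<exists>p. good k p"]
    by metis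
  then obtain p where p: "good k p" by blast
  have "G q \<le> t * nsq UNIV q" if q: "\<And>i. i < k \<Longrightarrow> ip UNIV (p i) q = 0" for q
  proof (rule ccontr)
    assume neg: "\<not> G q \<le> t * nsq UNIV q"
    define c where "c = sqrt (nsq UNIV q)"
    have "nsq UNIV q \<noteq> 0"
    proof
      assume "nsq UNIV q = 0"
      then have "\<And>x. q x = 0" by (simp add: nsq_eq_0_iff)
      then have "G q = 0" by (simp add: G_def ip_def nsq_def)
      with neg \<open>nsq UNIV q = 0\<close> show False by simp
    qed
    then have cpos: "0 < nsq UNIV q" "0 < c" "c\<^sup>2 = nsq UNIV q"
      using nsq_nonneg[of UNIV q] by (auto simp: c_def less_le)
    define e where "e = (\<lambda>x. of_real (1 / c) * q x)"
    have e1: "ip UNIV e e = 1"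
      unfolding ip_self e_def nsq_scale using cpos by (simp add: power_divide norm_divide)
    have e2: "ip UNIV (p i) e = 0" "ip UNIV e (p i) = 0" if "i < k" for i
    proof -
      show "ip UNIV (p i) e = 0" using q[OF that] unfolding e_def ip_scale_right by simp
      then show "ip UNIV e (p i) = 0" using cnj_ip[of UNIV "p i" e] by simp
    qed
    have "G e = G q / c\<^sup>2"
      unfolding G_def nsq_def ip_def e_def
      by (simp add: sum_divide_distrib[symmetric] norm_divide power_divide)
    then have "G q = nsq UNIV q * G e"
      using cpos by simp
    then have e3: "t \<le> G e"
      using neg cpos by (simp add: mult.commute[of t])
    \<comment> \<open>A direction violating the bound could be normalised and appended, against the
      maximality of \<open>k\<close>.\<close>
    have "good (Suc k) (p(k := e))"
      using p e1 e2 e3 unfolding good_def onsys_def by (auto simp: less_Suc_eq)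
    then show False
      using k(2)[of "Suc k"] by auto
  qed
  then show thesis
    using that[of k p] p bound[OF p] unfolding G_def C_def good_def by blast
qed

subsection \<open>Symmetric tensors and the forms they induce\<close>

abbreviation words :: "nat \<Rightarrow> 'd list set" where
  "words n \<equiv> {xs. length xs = n}"

lemma finite_words [simp]: "finite (words n :: 'd::finite list set)"
  using finite_lists_length_eq[of "UNIV :: 'd set" n] by simp

lemma sum_words_Suc:
  "(\<Sum>xs\<in>words (Suc n). g xs) = (\<Sum>x\<in>UNIV. \<Sum>xs\<in>words n. g (x # xs))"
  for g :: "'d::finite list \<Rightarrow> 'a::comm_monoid_add"
proof -
  have "(\<Sum>xs\<in>words (Suc n). g xs) = (\<Sum>(x, xs)\<in>UNIV \<times> words n. g (x # xs))"
    by (rule sum.reindex_bij_witness[of _ "\<lambda>(x, xs). x # xs" "\<lambda>xs. (hd xs, tl xs)"])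
      (auto simp: length_Suc_conv)
  then show ?thesis
    by (simp add: sum.cartesian_product)
qed

lemma words_0 [simp]: "words 0 = {[]}"
  by auto

text \<open>Comparing multisets treats all lengths at once, and the property passes to the tensor
  with its first entry fixed. This makes induction on the number of factors possible.\<close>

definition symmetric_fn :: "('d list \<Rightarrow> complex) \<Rightarrow> bool" where
  "symmetric_fn \<psi> \<longleftrightarrow> (\<forall>xs ys. mset xs = mset ys \<longrightarrow> \<psi> xs = \<psi> ys)"

lemma symmetric_fnD: "symmetric_fn \<psi> \<Longrightarrow> mset xs = mset ys \<Longrightarrow> \<psi> xs = \<psi> ys"
  unfolding symmetric_fn_def by blast

lemma symmetric_fn_Cons: "symmetric_fn \<psi> \<Longrightarrow> symmetric_fn (\<lambda>xs. \<psi> (x # xs))"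
  unfolding symmetric_fn_def by (metis mset.simps(2))

lemma symmetric_fn_Cons2: "symmetric_fn \<psi> \<Longrightarrow> \<psi> (x # y # xs) = \<psi> (y # x # xs)"
  by (rule symmetric_fnD) (simp_all add: add_mset_commute)

lemma symmetric_fn_sum:
  "(\<And>x. x \<in> A \<Longrightarrow> symmetric_fn (\<psi> x)) \<Longrightarrow> symmetric_fn (\<lambda>xs. \<Sum>x\<in>A. c x * \<psi> x xs)"
  unfolding symmetric_fn_def by (intro allI impI sum.cong refl arg_cong2[of _ _ _ _ "(*)"]) blast

lemma sym_space_eq: "sym_space N = {\<psi> \<in> tensor_space N. symmetric_fn \<psi>}"
proof -
  have "symmetric_fn \<psi>" if "\<psi> \<in> sym_space N" for \<psi> :: "'a list \<Rightarrow> complex"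
    unfolding symmetric_fn_def
  proof (intro allI impI)
    fix xs ys :: "'a list"
    assume eq: "mset xs = mset ys"
    show "\<psi> xs = \<psi> ys"
    proof (cases "length ys = N")
      case True
      obtain p where "p permutes {..<length ys}" "permute_list p ys = xs"
        using mset_eq_permutation[OF eq] by blast
      with True that show ?thesis by (auto simp: sym_space_def)
    next
      case False
      then show ?thesis
        using that mset_eq_length[OF eq] by (simp add: sym_space_def tensor_space_def)
    qed
  qed
  moreover have "\<psi> \<in> sym_space N" if "\<psi> \<in> tensor_space N" "symmetric_fn \<psi>" for \<psi> :: "'a list \<Rightarrow> complex"
    using that by (auto simp: sym_space_def intro!: symmetric_fnD)
  ultimately show ?thesis
    by (auto simp: sym_space_def)
qed

section \<open>Pairing symmetric tensors with tensor powers\<close>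

text \<open>Without conjugation this is a homogeneous polynomial in \<open>u\<close>, easily
  differentiated along lines. As an inner product it is the overlap of \<open>\<psi>\<close> with
  the tensor power of the conjugate of \<open>u\<close>, which is why conjugates of \<open>u\<close>
  appear in the Hartree terms later.\<close>

definition power_form :: "nat \<Rightarrow> ('d \<Rightarrow> complex) \<Rightarrow> ('d list \<Rightarrow> complex) \<Rightarrow> complex" where
  "power_form n u \<psi> = (\<Sum>zs\<in>words n. prod_list (map u zs) * \<psi> zs)"

lemma power_form_0 [simp]: "power_form 0 u \<psi> = \<psi> []"
  by (simp add: power_form_def)

lemma power_form_Suc:
  "power_form (Suc n) u \<psi> = (\<Sum>x\<in>UNIV. u x * power_form n u (\<lambda>zs. \<psi> (x # zs)))"
  for u :: "'d::finite \<Rightarrow> complex"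
  by (simp add: power_form_def sum_words_Suc sum_distrib_left mult_ac)

lemma power_form_scale: "power_form n (\<lambda>x. a * u x) \<psi> = a ^ n * power_form n u \<psi>"
  for u :: "'d::finite \<Rightarrow> complex"
  by (induction n arbitrary: \<psi>) (simp_all add: power_form_Suc sum_distrib_left mult_ac)

text \<open>By the product rule each of the \<open>n\<close> factors is replaced by \<open>v\<close>
  in turn; symmetry moves the replaced factor to the front, so all \<open>n\<close> contributions
  agree.\<close>

lemma power_form_has_derivative:
  fixes u v :: "'d::finite \<Rightarrow> complex"
  assumes "symmetric_fn \<psi>"
  shows "((\<lambda>t. power_form n (\<lambda>x. u x + of_real t * v x) \<psi>) has_vector_derivative
    of_nat n * (\<Sum>x\<in>UNIV. v x * power_form (n - 1) (\<lambda>x. u x + of_real t * v x) (\<lambda>zs. \<psi> (x # zs)))) (at t)"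
  using assms
proof (induction n arbitrary: \<psi>)
  case 0
  then show ?case by simp
next
  case (Suc n)
  define w where "w t = (\<lambda>x. u x + complex_of_real t * v x)" for t
  have IH: "((\<lambda>t. power_form n (w t) (\<lambda>zs. \<psi> (x # zs))) has_vector_derivative
      of_nat n * (\<Sum>y\<in>UNIV. v y * power_form (n - 1) (w t) (\<lambda>zs. \<psi> (x # y # zs)))) (at t)" for x
    unfolding w_def by (rule Suc.IH) (rule symmetric_fn_Cons[OF Suc.prems])
  have wd: "((\<lambda>t. w t x) has_vector_derivative v x) (at t)" for x
    unfolding w_def by (auto intro!: derivative_eq_intros)
  have "((\<lambda>t. power_form (Suc n) (w t) \<psi>) has_vector_derivative
      (\<Sum>x\<in>UNIV. w t x * (of_nat n * (\<Sum>y\<in>UNIV. v y * power_form (n - 1) (w t) (\<lambda>zs. \<psi> (x # y # zs))))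
         + v x * power_form n (w t) (\<lambda>zs. \<psi> (x # zs)))) (at t)"
    unfolding power_form_Suc
    by (intro has_vector_derivative_sum has_vector_derivative_mult wd IH)
  moreover have "(\<Sum>x\<in>UNIV. w t x * (of_nat n * (\<Sum>y\<in>UNIV. v y * power_form (n - 1) (w t) (\<lambda>zs. \<psi> (x # y # zs)))))
      = of_nat n * (\<Sum>y\<in>UNIV. v y * power_form n (w t) (\<lambda>zs. \<psi> (y # zs)))"
  proof (cases n)
    case 0
    then show ?thesis by simp
  next
    case (Suc m)
    have "(\<Sum>x\<in>UNIV. w t x * (\<Sum>y\<in>UNIV. v y * power_form m (w t) (\<lambda>zs. \<psi> (x # y # zs))))
        = (\<Sum>y\<in>UNIV. \<Sum>x\<in>UNIV. v y * (w t x * power_form m (w t) (\<lambda>zs. \<psi> (x # y # zs))))"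
      by (subst sum.swap) (simp add: sum_distrib_left mult_ac)
    also have "\<dots> = (\<Sum>y\<in>UNIV. v y * power_form n (w t) (\<lambda>zs. \<psi> (y # zs)))"
      unfolding Suc power_form_Suc sum_distrib_left
      by (intro sum.cong refl) (simp add: symmetric_fn_Cons2[OF Suc.prems])
    finally have "(\<Sum>x\<in>UNIV. w t x * (\<Sum>y\<in>UNIV. v y * power_form m (w t) (\<lambda>zs. \<psi> (x # y # zs))))
        = (\<Sum>y\<in>UNIV. v y * power_form n (w t) (\<lambda>zs. \<psi> (y # zs)))" .
    moreover have "(\<Sum>x\<in>UNIV. w t x * (a * S x)) = a * (\<Sum>x\<in>UNIV. w t x * S x)" for a S
      by (subst sum_distrib_left) (simp add: mult.left_commute)
    ultimately show ?thesis
      by (simp only: Suc diff_Suc_1)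
  qed
  moreover have "a * s + s = of_nat (Suc n) * s" if "a = of_nat n" for a s :: complex
    using that by (simp add: distrib_right)
  ultimately show ?case
    unfolding w_def[symmetric] by (simp only: sum.distrib diff_Suc_1)
qed

text \<open>Polarisation: a polynomial that vanishes identically has vanishing derivatives.
  Differentiating at \<open>u\<close> along the basis vector of \<open>y\<close> fixes the first
  entry to \<open>y\<close> and lowers the degree by one.\<close>

lemma power_form_eq_0_imp:
  fixes \<psi> :: "'d::finite list \<Rightarrow> complex"
  assumes "symmetric_fn \<psi>" "\<And>u. power_form n u \<psi> = 0" "length xs = n"
  shows "\<psi> xs = 0"
  using assms
proof (induction n arbitrary: \<psi> xs)
  case 0
  then show ?case by simp
next
  case (Suc n)
  obtain y ys where xs: "xs = y # ys" "length ys = n"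
    using Suc.prems(3) by (auto simp: length_Suc_conv)
  have "power_form n u (\<lambda>zs. \<psi> (y # zs)) = 0" for u
  proof -
    define v where "v x = (if x = y then 1 else 0 :: complex)" for x
    have "((\<lambda>t. 0) has_vector_derivative
      of_nat (Suc n) * (\<Sum>x\<in>UNIV. v x * power_form n u (\<lambda>zs. \<psi> (x # zs)))) (at (0::real))"
      using power_form_has_derivative[OF Suc.prems(1), of "Suc n" u v 0] Suc.prems(2) by simp
    then have "of_nat (Suc n) * (\<Sum>x\<in>UNIV. v x * power_form n u (\<lambda>zs. \<psi> (x # zs))) = 0"
      by (rule vector_derivative_unique_at) (rule has_vector_derivative_const)
    then have "(\<Sum>x\<in>UNIV. v x * power_form n u (\<lambda>zs. \<psi> (x # zs))) = 0"
      by (metis of_nat_eq_0_iff mult_eq_0_iff nat.distinct(1))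
    then show ?thesis
      by (simp add: v_def if_distrib[of "\<lambda>a. a * _"] cong: if_cong)
  qed
  then show ?case
    using Suc.IH[of "\<lambda>zs. \<psi> (y # zs)" ys] symmetric_fn_Cons[OF Suc.prems(1)] xs by simp
qed

section \<open>Tools for the variational arguments\<close>

text \<open>The point 0 is a minimum of \<open>h\<close>. If \<open>D\<close> were negative,
  \<open>h'\<close> would be negative just to the right of 0 and \<open>h\<close> would fall below 0
  there.\<close>

lemma second_derivative_test:
  fixes h h' :: "real \<Rightarrow> real"
  assumes h: "\<And>t. (h has_real_derivative h' t) (at t)"
    and h': "(h' has_real_derivative D) (at 0)"
    and nonneg: "\<And>t. 0 \<le> h t" and "h 0 = 0"
  shows "h' 0 = 0" "0 \<le> D"
proof -
  show h0: "h' 0 = 0"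
    using DERIV_local_min[OF h[of 0], of 1] nonneg \<open>h 0 = 0\<close> by simp
  show "0 \<le> D"
  proof (rule ccontr)
    assume "\<not> 0 \<le> D"
    then obtain d where d: "0 < d" "\<And>t. 0 < t \<Longrightarrow> t < d \<Longrightarrow> h' t < 0"
      using DERIV_neg_dec_right[OF h'] h0 by auto
    have "h 0 > h (d / 2)"
    proof (rule DERIV_neg_imp_decreasing_open[where f = h])
      show "\<exists>y. (h has_real_derivative y) (at x) \<and> y < 0" if "0 < x" "x < d / 2" for x
        using h d that by (intro exI[of _ "h' x"]) auto
      show "continuous_on {0..d / 2} h"
        using h by (meson DERIV_isCont continuous_at_imp_continuous_on)
    qed (use d in auto)
    with nonneg[of "d / 2"] \<open>h 0 = 0\<close> show False by simp
  qed
qed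

text \<open>The ambient function space may be infinite-dimensional, but the set is closed and lies
  in a product of closed unit discs and singletons, which is compact by Tychonoff's theorem.\<close>

lemma compact_nsq_sphere:
  assumes "finite (S :: 'i set)"
  shows "compact {f :: 'i \<Rightarrow> complex. (\<forall>x. x \<notin> S \<longrightarrow> f x = 0) \<and> nsq S f = 1}" (is "compact ?K")
proof -
  define C where "C x = (if x \<in> S then cball 0 1 else {0 :: complex})" for x
  have "compactin (product_topology (\<lambda>i. euclidean) UNIV) (PiE UNIV C)"
    unfolding compactin_PiE by (simp add: C_def)
  then have "compact (PiE UNIV C)"
    unfolding euclidean_product_topology by simp
  moreover have "continuous_on UNIV (\<lambda>f :: 'i \<Rightarrow> complex. f x)" for x
    by (rule continuous_on_product_coordinates)
  then have "closed ((\<Inter>x\<in>- S. {f :: 'i \<Rightarrow> complex. f x = 0}) \<inter> {f. nsq S f = 1})"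
    unfolding nsq_def
    by (intro closed_Int closed_INT ballI closed_Collect_eq continuous_intros) auto
  moreover have "?K = (\<Inter>x\<in>- S. {f. f x = 0}) \<inter> {f. nsq S f = 1}"
    by auto
  moreover have "?K \<subseteq> PiE UNIV C"
  proof
    fix f assume f: "f \<in> ?K"
    have "cmod (f x) \<le> 1" if "x \<in> S" for x
    proof -
      have "(cmod (f x))\<^sup>2 \<le> nsq S f"
        unfolding nsq_def by (rule member_le_sum[OF that _ assms]) auto
      then show ?thesis
        using f by (simp add: power_le_one_iff abs_square_le_1)
    qed
    with f show "f \<in> PiE UNIV C" by (auto simp: C_def)
  qed
  ultimately have "compact (PiE UNIV C \<inter> ?K)"
    by (simp only: compact_Int_closed)
  then show ?thesis
    using \<open>?K \<subseteq> PiE UNIV C\<close> by (simp only: Int_absorb1)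
qed

text \<open>The phase enters squared because it is applied to both arguments of a bilinear form. The
  witness is a square root of the conjugate of \<open>sgn X\<close>.\<close>

lemma exists_phase:
  obtains z where "cmod z = 1" "z\<^sup>2 * X = of_real (cmod X)"
proof (cases "X = 0")
  case True
  then show ?thesis using that[of 1] by simp
next
  case False
  have "cmod (csqrt (cnj (sgn X))) = 1"
    using False by (simp add: norm_sgn)
  moreover have "cnj X * X = (of_real (cmod X))\<^sup>2"
    by (simp add: complex_norm_square mult.commute del: of_real_power flip: of_real_power)
  then have "(csqrt (cnj (sgn X)))\<^sup>2 * X = of_real (cmod X)"
    unfolding power2_csqrt using False by (simp add: sgn_eq) (simp add: power2_eq_square)
  ultimately show ?thesis by (rule that)
qed

lemma has_real_derivative_Re_mult:
  "(f has_vector_derivative f') F \<Longrightarrow> ((\<lambda>t. Re (a * f t)) has_real_derivative Re (a * f')) F"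
  unfolding has_real_derivative_iff_has_vector_derivative
  by (intro bounded_linear.has_vector_derivative[OF bounded_linear_Re] has_vector_derivative_mult_right)

definition bil :: "('d::finite \<Rightarrow> 'd \<Rightarrow> complex) \<Rightarrow> ('d \<Rightarrow> complex) \<Rightarrow> ('d \<Rightarrow> complex) \<Rightarrow> complex" where
  "bil M v w = (\<Sum>x\<in>UNIV. \<Sum>y\<in>UNIV. v x * w y * M x y)"

text \<open>For \<open>x\<close> proportional to the square of \<open>t\<close>, both sides agree up
  to second order at \<open>t = 0\<close>. The smooth majorant therefore costs nothing in the second
  order condition.\<close>

lemma sqrt_power_le:
  assumes "0 \<le> x"
  shows "sqrt (1 + x) ^ N \<le> (1 + x / 2) ^ N"
proof (rule power_mono)
  have "1 + x \<le> (1 + x / 2)\<^sup>2"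
    by (simp add: power2_eq_square algebra_simps)
  then show "sqrt (1 + x) \<le> 1 + x / 2"
    using assms by (intro real_le_lsqrt) auto
qed (use assms in auto)

text \<open>
  If \<open>u\<close> maximises the overlap of \<open>u\<^sup>\<otimes>\<^sup>N\<close> with \<open>\<psi>\<close>, then contracting \<open>N - 1\<close> factors
  of \<open>\<psi>\<close> with \<open>u\<close> gives a multiple of \<open>u\<close> (first order), and contracting \<open>N - 2\<close>
  factors gives a small operator norm on the orthogonal complement of \<open>u\<close> (second order).
\<close>

lemma maximal_overlap:
  fixes u :: "'d::finite \<Rightarrow> complex"
  assumes N: "2 \<le> N" and sym: "symmetric_fn \<psi>" and u: "nsq UNIV u = 1"
    and c: "c = power_form N u \<psi>" "c \<noteq> 0"
    and mx: "\<And>w. cmod (power_form N w \<psi>) \<le> cmod c * sqrt (nsq UNIV w) ^ N"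
  shows "power_form (N - 1) u (\<lambda>zs. \<psi> (x # zs)) = c * cnj (u x)"
    and "ip UNIV u v = 0 \<Longrightarrow>
      cmod (bil (\<lambda>x y. power_form (N - 2) u (\<lambda>zs. \<psi> (x # y # zs))) v v)
        \<le> cmod c / (real N - 1) * nsq UNIV v"
proof -
  define f where "f x = power_form (N - 1) u (\<lambda>zs. \<psi> (x # zs))" for x
  define m where "m x y = power_form (N - 2) u (\<lambda>zs. \<psi> (x # y # zs))" for x y
  have key: "Re (cnj c * (\<Sum>x\<in>UNIV. v x * f x)) = 0"
      "(real N - 1) * Re (cnj c * bil m v v) \<le> (cmod c)\<^sup>2 * nsq UNIV v"
    if v: "ip UNIV u v = 0" for v
  proof -
    define s where "s = nsq UNIV v"
    define K where "K = (cmod c)\<^sup>2"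
    define w where "w t = (\<lambda>x. u x + complex_of_real t * v x)" for t
    define T1 where "T1 t = (\<Sum>x\<in>UNIV. v x * power_form (N - 1) (w t) (\<lambda>zs. \<psi> (x # zs)))" for t
    define T2 where "T2 t = (\<Sum>x\<in>UNIV. v x * (\<Sum>y\<in>UNIV. v y * power_form (N - 2) (w t) (\<lambda>zs. \<psi> (x # y # zs))))" for t
    have F: "((\<lambda>t. power_form N (w t) \<psi>) has_vector_derivative of_nat N * T1 t) (at t)" for t
      unfolding w_def T1_def by (rule power_form_has_derivative[OF sym])
    have "((\<lambda>t. T1 t) has_vector_derivative
        (\<Sum>x\<in>UNIV. v x * (of_nat (N - 1) * (\<Sum>y\<in>UNIV. v y * power_form (N - 1 - 1) (w t) (\<lambda>zs. \<psi> (x # y # zs)))))) (at t)" for t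
      unfolding w_def T1_def
      by (intro has_vector_derivative_sum has_vector_derivative_mult_right
          power_form_has_derivative symmetric_fn_Cons sym)
    moreover have "(\<Sum>x\<in>UNIV. v x * (of_nat (N - 1) * (\<Sum>y\<in>UNIV. v y * power_form (N - 1 - 1) (w t) (\<lambda>zs. \<psi> (x # y # zs)))))
        = of_nat (N - 1) * T2 t" for t
      unfolding T2_def using N
      by (subst sum_distrib_left) (simp add: mult.left_commute numeral_2_eq_2)
    ultimately have G: "((\<lambda>t. T1 t) has_vector_derivative of_nat (N - 1) * T2 t) (at t)" for t
      by simp
    \<comment> \<open>The gap between a majorant of the overlap along the line \<open>w t\<close>
      and the overlap itself, rotated by \<open>cnj c\<close>. Maximality of \<open>u\<close> makes
      it nonnegative, and it vanishes at 0.\<close>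
    define h where "h t = K * (1 + t\<^sup>2 * s / 2) ^ N - Re (cnj c * power_form N (w t) \<psi>)" for t
    define h' where "h' t = K * real N * (1 + t\<^sup>2 * s / 2) ^ (N - 1) * (t * s) - Re ((cnj c * of_nat N) * T1 t)" for t
    have "(h has_real_derivative h' t) (at t)" for t
    proof -
      have "((\<lambda>t. Re (cnj c * power_form N (w t) \<psi>)) has_real_derivative Re (cnj c * (of_nat N * T1 t))) (at t)"
        by (rule has_real_derivative_Re_mult[OF F])
      moreover have "((\<lambda>t. K * (1 + t\<^sup>2 * s / 2) ^ N) has_real_derivative
          K * real N * (1 + t\<^sup>2 * s / 2) ^ (N - 1) * (t * s)) (at t)"
        by (auto intro!: derivative_eq_intros)
      ultimately show ?thesis
        unfolding h_def h'_def mult.assoc[of "cnj c"] by (intro DERIV_diff)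
    qed
    moreover have "(h' has_real_derivative K * real N * s - Re ((cnj c * of_nat N) * (of_nat (N - 1) * T2 0))) (at 0)"
    proof -
      have "((\<lambda>t. Re ((cnj c * of_nat N) * T1 t)) has_real_derivative
          Re ((cnj c * of_nat N) * (of_nat (N - 1) * T2 0))) (at 0)"
        by (rule has_real_derivative_Re_mult[OF G])
      moreover have "((\<lambda>t. K * real N * (1 + t\<^sup>2 * s / 2) ^ (N - 1) * (t * s)) has_real_derivative
          K * real N * s) (at 0)"
        by (auto intro!: derivative_eq_intros)
      ultimately show ?thesis
        unfolding h'_def by (intro DERIV_diff)
    qed
    moreover have "0 \<le> h t" for t
    proof -
      have nw: "nsq UNIV (w t) = 1 + t\<^sup>2 * s"
        unfolding w_def nsq_add nsq_scale ip_scale_right v u s_def by simp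
      have "Re (cnj c * power_form N (w t) \<psi>) \<le> cmod c * cmod (power_form N (w t) \<psi>)"
        using complex_Re_le_cmod[of "cnj c * power_form N (w t) \<psi>"] by (simp add: norm_mult)
      also have "\<dots> \<le> cmod c * (cmod c * sqrt (1 + t\<^sup>2 * s) ^ N)"
        using mx[of "w t"] nw by (intro mult_left_mono) auto
      also have "\<dots> \<le> K * (1 + t\<^sup>2 * s / 2) ^ N"
        unfolding K_def power2_eq_square[of "cmod c"] mult.assoc[symmetric]
        by (intro mult_left_mono sqrt_power_le) (auto simp: s_def)
      finally show ?thesis by (simp add: h_def)
    qed
    moreover have w0: "w 0 = u"
      by (simp add: w_def)
    have "h 0 = 0"
      unfolding h_def w0 c(1)[symmetric] K_def
      by (simp add: cmod_power2 flip: complex_norm_square) (simp add: power2_eq_square)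
    ultimately have D: "h' 0 = 0" "0 \<le> K * real N * s - Re ((cnj c * of_nat N) * (of_nat (N - 1) * T2 0))"
      by (rule second_derivative_test)+
    have T1: "T1 0 = (\<Sum>x\<in>UNIV. v x * f x)"
      by (simp add: T1_def w0 f_def)
    have T2: "T2 0 = bil m v v"
      by (simp add: T2_def w0 bil_def m_def sum_distrib_left mult.assoc)
    have "real N * Re (cnj c * (\<Sum>x\<in>UNIV. v x * f x)) = 0"
      using D(1) unfolding h'_def T1 by (simp add: algebra_simps)
    then show "Re (cnj c * (\<Sum>x\<in>UNIV. v x * f x)) = 0"
      using N by simp
    have "Re ((cnj c * of_nat N) * (of_nat (N - 1) * T2 0)) = real N * (real (N - 1) * Re (cnj c * T2 0))"
      by (simp add: algebra_simps)
    then have "real N * (real (N - 1) * Re (cnj c * T2 0)) \<le> real N * (K * s)"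
      using D(2) by (simp add: algebra_simps)
    then have "real (N - 1) * Re (cnj c * T2 0) \<le> K * s"
      using N by simp
    then show "(real N - 1) * Re (cnj c * bil m v v) \<le> (cmod c)\<^sup>2 * nsq UNIV v"
      using N by (simp add: T2 K_def s_def of_nat_diff)
  qed
  \<comment> \<open>Testing with \<open>v\<close> and with \<open>\<i> * v\<close> removes the real
    and the imaginary part.\<close>
  have zero: "(\<Sum>x\<in>UNIV. v x * f x) = 0" if v: "ip UNIV u v = 0" for v
  proof -
    have "ip UNIV u (\<lambda>x. \<i> * v x) = 0"
      unfolding ip_scale_right v by simp
    from key(1)[OF this] have "Re (\<i> * (cnj c * (\<Sum>x\<in>UNIV. v x * f x))) = 0"
      by (simp add: sum_distrib_left mult_ac)
    then have "cnj c * (\<Sum>x\<in>UNIV. v x * f x) = 0"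
      using key(1)[OF v] by (simp add: complex_eq_iff)
    then show ?thesis using c by simp
  qed
  show "power_form (N - 1) u (\<lambda>zs. \<psi> (x # zs)) = c * cnj (u x)"
  proof -
    define e where "e y = (if y = x then 1 else 0 :: complex)" for y
    have "c = (\<Sum>y\<in>UNIV. u y * f y)"
      using N power_form_Suc[of "N - 1" u \<psi>] by (simp add: c f_def)
    moreover have e: "ip UNIV u e = cnj (u x)"
      by (simp add: ip_def e_def if_distrib cong: if_cong)
    \<comment> \<open>Subtracting its component along \<open>u\<close> makes the basis vector
      admissible in \<open>zero\<close>.\<close>
    have "ip UNIV u (\<lambda>y. e y - cnj (u x) * u y) = 0"
      unfolding ip_diff_right ip_scale_right e ip_self u by simp
    from zero[OF this] have "(\<Sum>y\<in>UNIV. e y * f y) = cnj (u x) * (\<Sum>y\<in>UNIV. u y * f y)"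
      by (simp add: left_diff_distrib sum_subtractf sum_distrib_left mult.assoc)
    moreover have "(\<Sum>y\<in>UNIV. e y * f y) = f x"
      by (simp add: e_def if_distrib[of "\<lambda>a. a * _"] cong: if_cong)
    ultimately show ?thesis
      by (simp add: f_def mult.commute)
  qed
  show "cmod (bil (\<lambda>x y. power_form (N - 2) u (\<lambda>zs. \<psi> (x # y # zs))) v v)
        \<le> cmod c / (real N - 1) * nsq UNIV v" if v: "ip UNIV u v = 0"
  proof -
    \<comment> \<open>Rotating \<open>v\<close> by \<open>z\<close> keeps its norm and turns the
      real part controlled by \<open>key\<close> into the modulus.\<close>
    obtain z where z: "cmod z = 1" "z\<^sup>2 * (cnj c * bil m v v) = of_real (cmod (cnj c * bil m v v))"
      by (rule exists_phase)
    have iv: "ip UNIV u (\<lambda>x. z * v x) = 0"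
      unfolding ip_scale_right v by simp
    have "cnj c * bil m (\<lambda>x. z * v x) (\<lambda>x. z * v x) = z\<^sup>2 * (cnj c * bil m v v)"
      by (simp add: bil_def sum_distrib_left power2_eq_square mult_ac)
    then have "Re (cnj c * bil m (\<lambda>x. z * v x) (\<lambda>x. z * v x)) = cmod c * cmod (bil m v v)"
      unfolding z(2) by (simp add: norm_mult)
    then have "(real N - 1) * (cmod c * cmod (bil m v v)) \<le> cmod c * cmod c * nsq UNIV v"
      using key(2)[OF iv] z(1) by (simp only: nsq_scale power2_eq_square mult_1_left one_power2 power_one)
    then have "(real N - 1) * cmod (bil m v v) \<le> cmod c * nsq UNIV v"
      using c by (simp add: mult.left_commute mult.assoc)
    then show ?thesis
      using N unfolding m_def by (simp add: field_simps)
  qed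
qed

lemma bil_sum_left: "bil M (\<lambda>x. a * v x + b * v' x) w = a * bil M v w + b * bil M v' w"
  by (simp add: bil_def sum_distrib_left sum.distrib algebra_simps)

lemma bil_sum_right: "bil M v (\<lambda>x. a * w x + b * w' x) = a * bil M v w + b * bil M v w'"
  by (simp add: bil_def sum_distrib_left sum.distrib algebra_simps)

lemma bil_commute:
  assumes "\<And>x y. M x y = M y x"
  shows "bil M v w = bil M w v"
proof -
  have "bil M v w = (\<Sum>y\<in>UNIV. \<Sum>x\<in>UNIV. v x * w y * M x y)"
    unfolding bil_def by (rule sum.swap)
  also have "\<dots> = (\<Sum>y\<in>UNIV. \<Sum>x\<in>UNIV. w y * v x * M y x)"
    using assms by (intro sum.cong refl) (simp add: mult_ac)
  finally show ?thesis
    unfolding bil_def .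
qed

text \<open>Polarisation carries the diagonal bound over to pairs of vectors orthogonal to
  \<open>u\<close>. Components along \<open>u\<close> do not matter since \<open>M\<close>
  annihilates \<open>u\<close>. Keeping the exact residual norm of \<open>v\<close> is what yields
  \<open>CARD('d) - 1\<close> instead of \<open>CARD('d)\<close> later.\<close>

lemma bil_polarization_bound:
  fixes M :: "'d::finite \<Rightarrow> 'd \<Rightarrow> complex"
  assumes M: "\<And>x y. M x y = M y x" and u: "nsq UNIV u = 1" "\<And>w. bil M u w = 0"
    and diag: "\<And>v. ip UNIV u v = 0 \<Longrightarrow> cmod (bil M v v) \<le> \<kappa> * nsq UNIV v" and "0 \<le> \<kappa>"
  shows "cmod (bil M v w) \<le> \<kappa> * sqrt (nsq UNIV v - (cmod (ip UNIV u v))\<^sup>2) * sqrt (nsq UNIV w)"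
proof -
  define r where "r v = (\<lambda>x. v x - ip UNIV u v * u x)" for v
  have r0: "ip UNIV u (r v) = 0" for v
    unfolding r_def ip_diff_right ip_scale_right ip_self u by simp
  have rn: "nsq UNIV (r v) = nsq UNIV v - (cmod (ip UNIV u v))\<^sup>2" for v
  proof -
    have "onsys 1 (\<lambda>_. u)" by (simp add: onsys_def ip_self u)
    from nsq_minus_proj[OF this, of v] nsq_proj[OF this, of v] show ?thesis
      by (simp add: r_def proj_def)
  qed
  have orth: "cmod (bil M v w) \<le> \<kappa> * sqrt (nsq UNIV v) * sqrt (nsq UNIV w)"
    if v: "ip UNIV u v = 0" and w: "ip UNIV u w = 0" for v w
  proof (cases "nsq UNIV v = 0 \<or> nsq UNIV w = 0")
    case True
    then have "bil M v w = 0" by (auto simp: nsq_eq_0_iff bil_def)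
    then show ?thesis using \<open>0 \<le> \<kappa>\<close> by simp
  next
    case False
    define a where "a = sqrt (nsq UNIV v)"
    define b where "b = sqrt (nsq UNIV w)"
    have ab: "0 < a" "0 < b" "a\<^sup>2 = nsq UNIV v" "b\<^sup>2 = nsq UNIV w"
      using False nsq_nonneg[of UNIV v] nsq_nonneg[of UNIV w] by (auto simp: a_def b_def less_le)
    \<comment> \<open>Each vector is scaled by the norm of the other. Both then have norm
      \<open>a * b\<close>, and the parallelogram law loses nothing.\<close>
    define A where "A = complex_of_real b"
    define B where "B = complex_of_real a"
    define p where "p = (\<lambda>x. A * v x + B * w x)"
    define q where "q = (\<lambda>x. A * v x + (- B) * w x)"
    have "bil M p p - bil M q q = 4 * (A * B) * bil M v w"
      unfolding p_def q_def bil_sum_left bil_sum_right bil_commute[where v = w and w = v, OF M]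
      by (simp add: algebra_simps)
    moreover have "cmod (bil M p p - bil M q q) \<le> \<kappa> * nsq UNIV p + \<kappa> * nsq UNIV q"
    proof (rule order_trans[OF norm_triangle_ineq4], rule add_mono)
      show "cmod (bil M p p) \<le> \<kappa> * nsq UNIV p"
        by (rule diag) (simp only: p_def ip_add_right ip_scale_right v w, simp)
      show "cmod (bil M q q) \<le> \<kappa> * nsq UNIV q"
        by (rule diag) (simp only: q_def ip_add_right ip_scale_right v w, simp)
    qed
    moreover have "nsq UNIV p + nsq UNIV q = 4 * (a\<^sup>2 * b\<^sup>2)"
      unfolding p_def q_def nsq_add nsq_scale ip_scale_left ip_scale_right A_def B_def
      by (simp add: ab)
    ultimately have "cmod (4 * (A * B) * bil M v w) \<le> \<kappa> * (4 * (a\<^sup>2 * b\<^sup>2))"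
      by (simp add: distrib_left[symmetric])
    moreover have "cmod (4 * (A * B) * bil M v w) = 4 * (a * b) * cmod (bil M v w)"
      using ab by (simp add: norm_mult A_def B_def mult_ac)
    moreover have "\<kappa> * (4 * (a\<^sup>2 * b\<^sup>2)) = 4 * (a * b) * (\<kappa> * a * b)"
      by (simp only: power2_eq_square mult_ac)
    ultimately have "4 * (a * b) * cmod (bil M v w) \<le> 4 * (a * b) * (\<kappa> * a * b)"
      by simp
    then have "cmod (bil M v w) \<le> \<kappa> * a * b"
      by (rule mult_left_le_imp_le) (use ab in simp)
    then show ?thesis
      by (simp add: a_def b_def)
  qed
  have *: "bil M (r v) (r w) = bil M v w"
  proof -
    have "bil M (r v) (r w) = bil M (\<lambda>x. 1 * v x + (- ip UNIV u v) * u x) (\<lambda>x. 1 * w x + (- ip UNIV u w) * u x)"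
      by (simp add: r_def)
    also have "\<dots> = bil M v w"
      unfolding bil_sum_left bil_sum_right u(2) bil_commute[where v = v and w = u, OF M] by simp
    finally show ?thesis .
  qed
  have "cmod (bil M v w) \<le> \<kappa> * sqrt (nsq UNIV (r v)) * sqrt (nsq UNIV (r w))"
    using orth[OF r0 r0, of v w] * by simp
  also have "\<dots> \<le> \<kappa> * sqrt (nsq UNIV (r v)) * sqrt (nsq UNIV w)"
    using \<open>0 \<le> \<kappa>\<close> by (intro mult_left_mono) (simp_all add: rn[of w])
  finally show ?thesis by (simp add: rn)
qed

subsection \<open>Two-body energies and the mean-field eigenvalue equation\<close>

text \<open>The matrix element between \<open>\<phi>\<close> and \<open>\<psi>\<close> of
  \<open>W\<close> acting on the first two of \<open>n + 2\<close> factors.\<close>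

definition pair_form ::
    "nat \<Rightarrow> ('d::finite \<Rightarrow> 'd \<Rightarrow> 'd \<Rightarrow> 'd \<Rightarrow> complex) \<Rightarrow> ('d list \<Rightarrow> complex) \<Rightarrow> ('d list \<Rightarrow> complex) \<Rightarrow> complex" where
  "pair_form n W \<phi> \<psi> = (\<Sum>zs\<in>words n. \<Sum>a\<in>UNIV. \<Sum>b\<in>UNIV. \<Sum>c\<in>UNIV. \<Sum>d\<in>UNIV.
     cnj (\<phi> (a # b # zs)) * W a b c d * \<psi> (c # d # zs))"

lemma pair_form_add_left:
  "pair_form n W (\<lambda>xs. \<phi> xs + \<eta> xs) \<psi> = pair_form n W \<phi> \<psi> + pair_form n W \<eta> \<psi>"
  by (simp add: pair_form_def distrib_right sum.distrib)

lemma pair_form_add_right: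
  "pair_form n W \<phi> (\<lambda>xs. \<psi> xs + \<eta> xs) = pair_form n W \<phi> \<psi> + pair_form n W \<phi> \<eta>"
  by (simp add: pair_form_def distrib_left sum.distrib)

lemma pair_form_scale_left: "pair_form n W (\<lambda>xs. k * \<phi> xs) \<psi> = cnj k * pair_form n W \<phi> \<psi>"
  by (simp add: pair_form_def sum_distrib_left mult_ac)

lemma pair_form_scale_right: "pair_form n W \<phi> (\<lambda>xs. k * \<psi> xs) = k * pair_form n W \<phi> \<psi>"
  by (simp add: pair_form_def sum_distrib_left mult_ac)

lemma cnj_pair_form:
  "cnj (pair_form n W \<phi> \<psi>) = pair_form n (\<lambda>a b c d. cnj (W c d a b)) \<psi> \<phi>"
  unfolding pair_form_def cnj_sum
  by (subst sum_swap_pairs) (simp add: mult_ac)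

lemma pair_form_cong:
  assumes "\<And>xs. length xs = n + 2 \<Longrightarrow> \<phi> xs = \<phi>' xs" "\<And>xs. length xs = n + 2 \<Longrightarrow> \<psi> xs = \<psi>' xs"
  shows "pair_form n W \<phi> \<psi> = pair_form n W \<phi>' \<psi>'"
  unfolding pair_form_def using assms by (intro sum.cong refl) simp

lemma linear_coeff_eq_0:
  fixes a b :: real
  assumes "\<And>t. 0 \<le> a * t + b * t\<^sup>2"
  shows "a = 0"
proof -
  have "((\<lambda>t. a * t + b * t\<^sup>2) has_real_derivative a + b * (2 * t)) (at t)" for t
    by (auto intro!: derivative_eq_intros)
  moreover have "((\<lambda>t. a + b * (2 * t)) has_real_derivative b * 2) (at 0)"
    by (auto intro!: derivative_eq_intros)
  ultimately have "a + b * (2 * 0) = 0"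
    by (rule second_derivative_test(1)) (use assms in auto)
  then show ?thesis by simp
qed

lemma closed_symmetric_fn: "closed {\<psi> :: 'd list \<Rightarrow> complex. symmetric_fn \<psi>}"
proof -
  have "{\<psi> :: 'd list \<Rightarrow> complex. symmetric_fn \<psi>}
      = (\<Inter>xs. \<Inter>ys\<in>{ys. mset xs = mset ys}. {\<psi>. \<psi> xs = \<psi> ys})"
    by (auto simp: symmetric_fn_def)
  moreover have "closed {\<psi> :: 'd list \<Rightarrow> complex. \<psi> xs = \<psi> ys}" for xs ys
    by (intro closed_Collect_eq continuous_on_product_coordinates)
  ultimately show ?thesis
    by (simp only:) (intro closed_INT ballI)
qed

text \<open>The energy is maximised over the compact unit sphere of symmetric tensors. The
  eigenvalue equation is tested only against symmetric \<open>\<phi>\<close>: acting on the first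
  two factors alone, \<open>W\<close> need not preserve symmetry.\<close>

lemma top_eigenvector:
  fixes W :: "'d::finite \<Rightarrow> 'd \<Rightarrow> 'd \<Rightarrow> 'd \<Rightarrow> complex"
  assumes W: "\<And>a b c d. W a b c d = cnj (W c d a b)"
  obtains \<psi> L where "symmetric_fn \<psi>" "nsq (words (n + 2)) \<psi> = 1"
    "\<And>\<phi>. symmetric_fn \<phi> \<Longrightarrow> Re (pair_form n W \<phi> \<phi>) \<le> L * nsq (words (n + 2)) \<phi>"
    "\<And>\<phi>. symmetric_fn \<phi> \<Longrightarrow> pair_form n W \<phi> \<psi> = of_real L * ip (words (n + 2)) \<phi> \<psi>"
proof -
  define S :: "'d list set" where "S = words (n + 2)"
  define K where "K = {\<psi> :: 'd list \<Rightarrow> complex. (\<forall>xs. xs \<notin> S \<longrightarrow> \<psi> xs = 0) \<and> nsq S \<psi> = 1} \<inter> {\<psi>. symmetric_fn \<psi>}"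
  \<comment> \<open>Cutting off at lists of other lengths moves a tensor into the compact set
    without changing its norm or energy.\<close>
  define R where "R \<psi> xs = (if xs \<in> S then \<psi> xs else 0 :: complex)" for \<psi> :: "'d list \<Rightarrow> complex" and xs
  have finS: "finite S" by (simp add: S_def)
  have R_sym: "symmetric_fn (R \<psi>)" if "symmetric_fn \<psi>" for \<psi>
    unfolding symmetric_fn_def
  proof (intro allI impI)
    fix xs ys :: "'d list" assume eq: "mset xs = mset ys"
    then have "xs \<in> S \<longleftrightarrow> ys \<in> S"
      using mset_eq_length[OF eq] by (simp add: S_def)
    then show "R \<psi> xs = R \<psi> ys"
      using symmetric_fnD[OF that eq] by (simp add: R_def)
  qed
  have R_nsq: "nsq S (R \<psi>) = nsq S \<psi>" for \<psi>
    by (rule nsq_cong) (simp add: R_def)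
  have R_form: "pair_form n W (R \<psi>) (R \<psi>) = pair_form n W \<psi> \<psi>" for \<psi>
    by (rule pair_form_cong) (simp_all add: R_def S_def)
  have "compact K"
    unfolding K_def by (intro compact_Int_closed compact_nsq_sphere finS closed_symmetric_fn)
  moreover have "K \<noteq> {}"
  proof -
    have "S \<noteq> {}"
      using Ex_list_of_length[of "n + 2"] by (auto simp: S_def)
    then have "0 < card S" using finS by (simp add: card_gt_0_iff)
    define k where "k = complex_of_real (1 / sqrt (card S))"
    have "nsq S (R (\<lambda>_. k)) = 1"
      unfolding R_nsq unfolding nsq_def k_def
      using \<open>0 < card S\<close> by (simp add: norm_divide power_divide)
    moreover have "symmetric_fn (\<lambda>_. k)"
      by (simp add: symmetric_fn_def)
    then have "symmetric_fn (R (\<lambda>_. k))"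
      by (rule R_sym)
    ultimately have "R (\<lambda>_. k) \<in> K"
      by (simp add: K_def R_def)
    then show ?thesis by blast
  qed
  moreover have "continuous_on K (\<lambda>\<psi>. Re (pair_form n W \<psi> \<psi>))"
  proof -
    have "continuous_on K (\<lambda>\<psi>. \<psi> xs)" for xs
      by (rule continuous_on_subset[OF continuous_on_product_coordinates]) simp
    then show ?thesis
      unfolding pair_form_def by (intro continuous_intros)
  qed
  ultimately obtain \<psi> where \<psi>: "\<psi> \<in> K"
      "\<And>\<phi>. \<phi> \<in> K \<Longrightarrow> Re (pair_form n W \<phi> \<phi>) \<le> Re (pair_form n W \<psi> \<psi>)"
    using continuous_attains_sup[of K "\<lambda>\<psi>. Re (pair_form n W \<psi> \<psi>)"] by blast
  define L where "L = Re (pair_form n W \<psi> \<psi>)"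
  have \<psi>K: "symmetric_fn \<psi>" "nsq S \<psi> = 1"
    using \<psi>(1) by (auto simp: K_def)
  have le: "Re (pair_form n W \<phi> \<phi>) \<le> L * nsq S \<phi>" if "symmetric_fn \<phi>" for \<phi>
  proof (cases "nsq S \<phi> = 0")
    case True
    then have "pair_form n W \<phi> \<phi> = pair_form n W (\<lambda>xs. 0) (\<lambda>xs. 0)"
      using finS by (intro pair_form_cong) (auto simp: nsq_eq_0_iff S_def)
    then show ?thesis using True by (simp add: pair_form_def)
  next
    case False
    define k where "k = complex_of_real (1 / sqrt (nsq S \<phi>))"
    have k: "(cmod k)\<^sup>2 * nsq S \<phi> = 1"
      using False nsq_nonneg[of S \<phi>] by (simp add: k_def norm_divide power_divide)
    define \<phi>' where "\<phi>' = R (\<lambda>xs. k * \<phi> xs)"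
    have "symmetric_fn (\<lambda>xs. k * \<phi> xs)"
      using that unfolding symmetric_fn_def by metis
    then have "\<phi>' \<in> K"
      using k by (auto simp: K_def \<phi>'_def R_sym R_nsq nsq_scale) (simp add: R_def)
    have "(cmod k)\<^sup>2 * Re (pair_form n W \<phi> \<phi>) = Re (pair_form n W \<phi>' \<phi>')"
      unfolding \<phi>'_def R_form pair_form_scale_left pair_form_scale_right
      by (simp add: k_def norm_divide power_divide power2_eq_square mult.assoc[symmetric])
    also have "\<dots> \<le> L * ((cmod k)\<^sup>2 * nsq S \<phi>)"
      using \<psi>(2)[OF \<open>\<phi>' \<in> K\<close>] k by (simp add: L_def)
    finally have "(cmod k)\<^sup>2 * Re (pair_form n W \<phi> \<phi>) \<le> (cmod k)\<^sup>2 * (L * nsq S \<phi>)"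
      by (simp add: mult.left_commute)
    moreover have "0 < (cmod k)\<^sup>2"
      using k by (cases "k = 0") auto
    ultimately show ?thesis by (rule mult_left_le_imp_le)
  qed
  have re: "Re (pair_form n W \<phi> \<psi>) = L * Re (ip S \<phi> \<psi>)" if \<phi>: "symmetric_fn \<phi>" for \<phi>
  proof -
    have herm: "Re (pair_form n W \<psi> \<phi>) = Re (pair_form n W \<phi> \<psi>)"
      using arg_cong[OF cnj_pair_form[of n W \<psi> \<phi>], of Re] unfolding W[symmetric] by simp
    have ips: "Re (ip S \<psi> \<phi>) = Re (ip S \<phi> \<psi>)"
      using arg_cong[OF cnj_ip[of S \<psi> \<phi>], of Re] by simp
    \<comment> \<open>Inserting \<open>\<psi> + t \<phi>\<close> into \<open>le\<close> gives a
      quadratic polynomial in \<open>t\<close> without constant term. Being nonnegative, it has no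
      linear term either.\<close>
    have "0 \<le> (2 * (L * Re (ip S \<phi> \<psi>) - Re (pair_form n W \<phi> \<psi>))) * t
        + (L * nsq S \<phi> - Re (pair_form n W \<phi> \<phi>)) * t\<^sup>2" for t
    proof -
      have "symmetric_fn (\<lambda>xs. \<psi> xs + of_real t * \<phi> xs)"
        using \<psi>K(1) \<phi> unfolding symmetric_fn_def by metis
      from le[OF this] show ?thesis
        unfolding pair_form_add_left pair_form_add_right pair_form_scale_left pair_form_scale_right
          nsq_add nsq_scale ip_scale_right
        by (simp add: herm ips \<psi>K(2) L_def[symmetric]) (simp add: algebra_simps power2_eq_square)
    qed
    from linear_coeff_eq_0[OF this] show ?thesis by simp
  qed
  have "pair_form n W \<phi> \<psi> = of_real L * ip S \<phi> \<psi>" if \<phi>: "symmetric_fn \<phi>" for \<phi>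
  proof -
    have "symmetric_fn (\<lambda>xs. \<i> * \<phi> xs)"
      using \<phi> unfolding symmetric_fn_def by metis
    from re[OF this] re[OF \<phi>] show ?thesis
      unfolding pair_form_scale_left ip_scale_left by (simp add: complex_eq_iff)
  qed
  then show thesis
    using that[of \<psi> L] \<psi>K le unfolding S_def by blast
qed

text \<open>Compactness of the unit sphere gives a maximiser, and homogeneity extends the bound to
  all \<open>w\<close>. The maximum is not zero, since a symmetric tensor vanishing on all powers is
  zero by \<open>power_form_eq_0_imp\<close>.\<close>

lemma exists_maximal_overlap:
  fixes \<psi> :: "'d::finite list \<Rightarrow> complex"
  assumes "symmetric_fn \<psi>" "nsq (words n) \<psi> \<noteq> 0" "0 < n"
  obtains u where "nsq UNIV u = 1" "power_form n u \<psi> \<noteq> 0"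
    "\<And>w. cmod (power_form n w \<psi>) \<le> cmod (power_form n u \<psi>) * sqrt (nsq UNIV w) ^ n"
proof -
  define K where "K = {u :: 'd \<Rightarrow> complex. (\<forall>x. x \<notin> UNIV \<longrightarrow> u x = 0) \<and> nsq UNIV u = 1}"
  have "compact K"
    unfolding K_def by (rule compact_nsq_sphere) simp
  moreover have "K \<noteq> {}"
  proof -
    obtain y :: 'd where True by blast
    have "nsq UNIV (\<lambda>x. if x = y then 1 else 0) = 1"
      by (simp add: nsq_def if_distrib[of cmod] if_distrib[of "\<lambda>a. a\<^sup>2"] cong: if_cong)
    then have "(\<lambda>x. if x = y then 1 else 0) \<in> K" by (simp add: K_def)
    then show ?thesis by blast
  qed
  moreover have "continuous_on K (\<lambda>u. cmod (power_form n u \<psi>))"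
  proof -
    have *: "continuous_on K (\<lambda>u. u x)" for x
      by (rule continuous_on_subset[OF continuous_on_product_coordinates]) simp
    have "continuous_on K (\<lambda>u. power_form n u \<psi>)"
    proof (induction n arbitrary: \<psi>)
      case 0
      then show ?case by simp
    next
      case (Suc n)
      then show ?case unfolding power_form_Suc by (intro continuous_intros *)
    qed
    then show ?thesis by (intro continuous_intros)
  qed
  ultimately obtain u where u: "u \<in> K" "\<And>w. w \<in> K \<Longrightarrow> cmod (power_form n w \<psi>) \<le> cmod (power_form n u \<psi>)"
    using continuous_attains_sup[of K "\<lambda>u. cmod (power_form n u \<psi>)"] by blast
  have mx: "cmod (power_form n w \<psi>) \<le> cmod (power_form n u \<psi>) * sqrt (nsq UNIV w) ^ n" for w
  proof -
    define a where "a = sqrt (nsq UNIV w)"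
    show ?thesis
    proof (cases "a = 0")
      case True
      then have "w = (\<lambda>x. 0 * w x)"
        by (auto simp: a_def nsq_eq_0_iff)
      then have "power_form n w \<psi> = 0 ^ n * power_form n w \<psi>"
        using power_form_scale[of n 0 w \<psi>] by simp
      then show ?thesis using \<open>0 < n\<close> by (simp add: zero_power)
    next
      case False
      then have a: "0 < a" "a\<^sup>2 = nsq UNIV w"
        using nsq_nonneg[of UNIV w] by (auto simp: a_def less_le)
      define w' where "w' = (\<lambda>x. of_real (1 / a) * w x)"
      have "nsq UNIV w' = 1"
        unfolding w'_def nsq_scale a(2)[symmetric] using a(1) by (simp add: norm_divide power_divide)
      then have "w' \<in> K"
        by (simp add: K_def)
      have "w = (\<lambda>x. of_real a * w' x)"
        using a by (simp add: w'_def)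
      then have "cmod (power_form n w \<psi>) = a ^ n * cmod (power_form n w' \<psi>)"
        using power_form_scale[of n "of_real a" w' \<psi>] a by (simp add: norm_mult norm_power)
      also have "\<dots> \<le> a ^ n * cmod (power_form n u \<psi>)"
        using u(2)[OF \<open>w' \<in> K\<close>] a by (intro mult_left_mono) auto
      finally show ?thesis by (simp add: a_def mult.commute)
    qed
  qed
  have "power_form n u \<psi> \<noteq> 0"
  proof
    assume "power_form n u \<psi> = 0"
    with mx have "power_form n w \<psi> = 0" for w by (metis norm_le_zero_iff norm_zero mult_zero_left)
    then have "\<psi> xs = 0" if "xs \<in> words n" for xs
      using power_form_eq_0_imp[OF assms(1)] that by blast
    then show False using assms(2) by (simp add: nsq_eq_0_iff)
  qed
  with u mx show thesis by (intro that[of u]) (auto simp: K_def)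
qed

section \<open>Hartree energies and the mean-field error\<close>

definition hartree :: "('d::finite \<Rightarrow> 'd \<Rightarrow> 'd \<Rightarrow> 'd \<Rightarrow> complex) \<Rightarrow> ('d \<Rightarrow> complex) \<Rightarrow> real" where
  "hartree W u = Re (\<Sum>a\<in>UNIV. \<Sum>b\<in>UNIV. \<Sum>c\<in>UNIV. \<Sum>d\<in>UNIV.
     cnj (u a) * cnj (u b) * W a b c d * (u c * u d))"

definition nsq4 :: "('d::finite \<Rightarrow> 'd \<Rightarrow> 'd \<Rightarrow> 'd \<Rightarrow> complex) \<Rightarrow> real" where
  "nsq4 W = (\<Sum>a\<in>UNIV. \<Sum>b\<in>UNIV. \<Sum>c\<in>UNIV. \<Sum>d\<in>UNIV. (cmod (W a b c d))\<^sup>2)"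

lemma symmetric_fn_prod_list: "symmetric_fn (\<lambda>xs. prod_list (map f xs))"
proof -
  have "prod_list (map f xs) = prod_mset (image_mset f (mset xs))" for xs
    by (simp flip: prod_mset_prod_list mset_map)
  then show ?thesis
    by (simp add: symmetric_fn_def)
qed

lemma cnj_prod_list: "cnj (prod_list (map f xs)) = prod_list (map (\<lambda>x. cnj (f x)) xs)"
  by (induction xs) auto

text \<open>The eigenvalue equation is paired with the product tensor of largest overlap and divided
  by that overlap. Contracting the remaining \<open>n\<close> factors leaves a product part, which
  gives the Hartree energy, and a remainder \<open>M\<close> controlled by the second order
  condition.\<close>

lemma top_eigenvalue_mean_field:
  fixes W :: "'d::finite \<Rightarrow> 'd \<Rightarrow> 'd \<Rightarrow> 'd \<Rightarrow> complex"
  assumes W: "\<And>a b c d. W a b c d = cnj (W c d a b)"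
  obtains L u M where "nsq UNIV u = 1"
    "\<And>\<phi>. symmetric_fn \<phi> \<Longrightarrow> Re (pair_form n W \<phi> \<phi>) \<le> L * nsq (words (n + 2)) \<phi>"
    "L = hartree W (\<lambda>x. cnj (u x))
       + Re (\<Sum>c\<in>UNIV. \<Sum>d\<in>UNIV. (\<Sum>a\<in>UNIV. \<Sum>b\<in>UNIV. u a * u b * W a b c d) * M c d)"
    "\<And>v w. cmod (bil M v w)
       \<le> 1 / (real n + 1) * sqrt (nsq UNIV v - (cmod (ip UNIV u v))\<^sup>2) * sqrt (nsq UNIV w)"
proof -
  obtain \<psi> L where \<psi>: "symmetric_fn \<psi>" "nsq (words (n + 2)) \<psi> = 1"
    and le: "\<And>\<phi>. symmetric_fn \<phi> \<Longrightarrow> Re (pair_form n W \<phi> \<phi>) \<le> L * nsq (words (n + 2)) \<phi>"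
    and ev: "\<And>\<phi>. symmetric_fn \<phi> \<Longrightarrow> pair_form n W \<phi> \<psi> = of_real L * ip (words (n + 2)) \<phi> \<psi>"
    by (rule top_eigenvector[OF W, where n = n]) (rule that)
  obtain u where u: "nsq UNIV u = 1" "power_form (n + 2) u \<psi> \<noteq> 0"
    "\<And>w. cmod (power_form (n + 2) w \<psi>) \<le> cmod (power_form (n + 2) u \<psi>) * sqrt (nsq UNIV w) ^ (n + 2)"
    by (rule exists_maximal_overlap[OF \<psi>(1), of "n + 2"]) (use \<psi>(2) in auto)
  define c0 where "c0 = power_form (n + 2) u \<psi>"
  define m where "m x y = power_form n u (\<lambda>zs. \<psi> (x # y # zs))" for x y
  \<comment> \<open>Subtracting the product part makes \<open>M\<close> annihilate \<open>u\<close>,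
    by the first order condition \<open>f\<close>.\<close>
  define M where "M x y = m x y / c0 - cnj (u x) * cnj (u y)" for x y
  have c0: "c0 \<noteq> 0" using u by (simp add: c0_def)
  have mx: "cmod (power_form (n + 2) w \<psi>) \<le> cmod c0 * sqrt (nsq UNIV w) ^ (n + 2)" for w
    using u(3) by (simp only: c0_def)
  have f: "power_form (n + 1) u (\<lambda>zs. \<psi> (x # zs)) = c0 * cnj (u x)" for x
    using maximal_overlap(1)[OF _ \<psi>(1) u(1) c0_def c0 mx, of x] by simp
  have msym: "m x y = m y x" for x y
    unfolding m_def using symmetric_fn_Cons2[OF \<psi>(1), of x y] by simp
  have "(\<Sum>x\<in>UNIV. u x * m x y) = c0 * cnj (u y)" for y
    using f[of y] power_form_Suc[of n u "\<lambda>zs. \<psi> (y # zs)"] msym by (simp add: m_def)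
  moreover have uu: "(\<Sum>x\<in>UNIV. u x * cnj (u x)) = 1"
    using ip_self[of UNIV u] u(1) by (simp add: ip_def mult.commute)
  ultimately have "(\<Sum>x\<in>UNIV. u x * M x y) = 0" for y
    using c0
    by (simp add: M_def right_diff_distrib sum_subtractf
        flip: sum_divide_distrib mult.assoc sum_distrib_right)
  then have Mu: "bil M u w = 0" for w
    unfolding bil_def
    by (subst sum.swap) (simp add: mult.assoc mult.left_commute[of "u _" "w _"] flip: sum_distrib_left)
  have diag: "cmod (bil M v v) \<le> 1 / (real n + 1) * nsq UNIV v" if v: "ip UNIV u v = 0" for v
  proof -
    have "bil M v v = bil m v v / c0 - ip UNIV u v * ip UNIV u v"
      unfolding bil_def M_def ip_def sum_product
      by (simp add: right_diff_distrib sum_subtractf sum_divide_distrib mult_ac)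
    then have "cmod (bil M v v) = cmod (bil m v v) / cmod c0"
      by (simp add: v norm_divide)
    moreover have "cmod (bil m v v) \<le> cmod c0 / (real n + 1) * nsq UNIV v"
      using maximal_overlap(2)[OF _ \<psi>(1) u(1) c0_def c0 mx v] by (simp add: m_def[abs_def] add.commute)
    ultimately have "cmod (bil M v v) \<le> (cmod c0 / (real n + 1) * nsq UNIV v) / cmod c0"
      by (simp only: divide_right_mono norm_ge_zero)
    then show ?thesis
      using c0 by simp
  qed
  have Msym: "M x y = M y x" for x y
    using msym[of x y] by (simp add: M_def mult.commute)
  have bound: "cmod (bil M v w)
       \<le> 1 / (real n + 1) * sqrt (nsq UNIV v - (cmod (ip UNIV u v))\<^sup>2) * sqrt (nsq UNIV w)" for v w
    by (rule bil_polarization_bound[OF Msym u(1) Mu diag]) auto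
  \<comment> \<open>The conjugates cancel those of the inner product, so the overlap with
    \<open>\<psi>\<close> is exactly \<open>c0\<close>.\<close>
  define \<phi> where "\<phi> xs = prod_list (map (\<lambda>x. cnj (u x)) xs)" for xs
  define w where "w c d = (\<Sum>a\<in>UNIV. \<Sum>b\<in>UNIV. u a * u b * W a b c d)" for c d
  have "pair_form n W \<phi> \<psi> = (\<Sum>c\<in>UNIV. \<Sum>d\<in>UNIV. w c d * m c d)"
  proof -
    have "pair_form n W \<phi> \<psi> = (\<Sum>zs\<in>words n. \<Sum>c\<in>UNIV. \<Sum>d\<in>UNIV. w c d * (prod_list (map u zs) * \<psi> (c # d # zs)))"
      unfolding pair_form_def w_def \<phi>_def cnj_prod_list sum_distrib_right
      by (subst sum_swap_pairs) (simp add: mult_ac)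
    also have "\<dots> = (\<Sum>c\<in>UNIV. \<Sum>d\<in>UNIV. \<Sum>zs\<in>words n. w c d * (prod_list (map u zs) * \<psi> (c # d # zs)))"
      by (subst sum.swap) (intro sum.cong refl sum.swap)
    finally show ?thesis
      by (simp add: m_def power_form_def sum_distrib_left)
  qed
  also have "\<dots> = c0 * (\<Sum>c\<in>UNIV. \<Sum>d\<in>UNIV. w c d * (cnj (u c) * cnj (u d)))
      + c0 * (\<Sum>c\<in>UNIV. \<Sum>d\<in>UNIV. w c d * M c d)"
  proof -
    have "w c d * m c d = c0 * (w c d * (cnj (u c) * cnj (u d))) + c0 * (w c d * M c d)" for c d
      using c0 by (simp add: M_def field_simps)
    then show ?thesis
      by (simp add: sum.distrib sum_distrib_left)
  qed
  finally have eq1: "pair_form n W \<phi> \<psi> = c0 * ((\<Sum>c\<in>UNIV. \<Sum>d\<in>UNIV. w c d * (cnj (u c) * cnj (u d)))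
      + (\<Sum>c\<in>UNIV. \<Sum>d\<in>UNIV. w c d * M c d))" (is "_ = c0 * (?X + ?Y)")
    by (simp only: distrib_left)
  have "symmetric_fn \<phi>"
    unfolding \<phi>_def by (rule symmetric_fn_prod_list)
  moreover have "ip (words (n + 2)) \<phi> \<psi> = c0"
    by (simp add: ip_def \<phi>_def cnj_prod_list c0_def power_form_def)
  ultimately have "c0 * (?X + ?Y) = c0 * of_real L"
    using ev[of \<phi>] unfolding eq1 by (simp only: mult.commute)
  then have "?X + ?Y = of_real L"
    by (rule mult_left_cancel[OF c0, THEN iffD1])
  then have "L = Re ?X + Re ?Y"
    by (metis Re_complex_of_real plus_complex.sel(1))
  moreover have "?X = (\<Sum>a\<in>UNIV. \<Sum>b\<in>UNIV. \<Sum>c\<in>UNIV. \<Sum>d\<in>UNIV. u a * u b * W a b c d * (cnj (u c) * cnj (u d)))"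
    unfolding w_def sum_distrib_right by (rule sum_swap_pairs)
  then have "Re ?X = hartree W (\<lambda>x. cnj (u x))"
    by (simp only: hartree_def complex_cnj_cnj)
  ultimately have "L = hartree W (\<lambda>x. cnj (u x)) + Re ?Y"
    by simp
  then show thesis
    by (intro that[of u L M] u(1) le bound) (simp_all add: w_def)
qed

text \<open>For fixed \<open>c\<close> and \<open>d\<close> this is Cauchy-Schwarz against the unit
  tensor built from two copies of \<open>u\<close>.\<close>

lemma nsq_contraction_le:
  fixes W :: "'d::finite \<Rightarrow> 'd \<Rightarrow> 'd \<Rightarrow> 'd \<Rightarrow> complex"
  assumes "nsq UNIV u = 1"
  shows "(\<Sum>c\<in>UNIV. nsq UNIV (\<lambda>d. \<Sum>a\<in>UNIV. \<Sum>b\<in>UNIV. u a * u b * W a b c d)) \<le> nsq4 W"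
proof -
  have "(cmod (\<Sum>a\<in>UNIV. \<Sum>b\<in>UNIV. u a * u b * W a b c d))\<^sup>2 \<le> (\<Sum>a\<in>UNIV. \<Sum>b\<in>UNIV. (cmod (W a b c d))\<^sup>2)" for c d
  proof -
    have "(\<Sum>a\<in>UNIV. \<Sum>b\<in>UNIV. u a * u b * W a b c d)
        = ip (UNIV \<times> UNIV) (\<lambda>p. cnj (u (fst p) * u (snd p))) (\<lambda>p. W (fst p) (snd p) c d)"
      unfolding ip_def sum_pairs by simp
    also have "(cmod \<dots>)\<^sup>2 \<le> nsq (UNIV \<times> UNIV) (\<lambda>p. cnj (u (fst p) * u (snd p)))
        * nsq (UNIV \<times> UNIV) (\<lambda>p. W (fst p) (snd p) c d)"
      by (rule cauchy_schwarz_sq)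
    also have "nsq (UNIV \<times> UNIV) (\<lambda>p. cnj (u (fst p) * u (snd p)))
        = (\<Sum>a\<in>UNIV. \<Sum>b\<in>UNIV. (cmod (u a))\<^sup>2 * (cmod (u b))\<^sup>2)"
      unfolding nsq_def sum_pairs by (simp add: norm_mult power_mult_distrib)
    also have "\<dots> = nsq UNIV u * nsq UNIV u"
      unfolding nsq_def by (rule sum_product[symmetric])
    also have "nsq (UNIV \<times> UNIV) (\<lambda>p. W (fst p) (snd p) c d) = (\<Sum>a\<in>UNIV. \<Sum>b\<in>UNIV. (cmod (W a b c d))\<^sup>2)"
      unfolding nsq_def sum_pairs by simp
    finally show ?thesis by (simp add: assms)
  qed
  then have "(\<Sum>c\<in>UNIV. nsq UNIV (\<lambda>d. \<Sum>a\<in>UNIV. \<Sum>b\<in>UNIV. u a * u b * W a b c d))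
      \<le> (\<Sum>c\<in>UNIV. \<Sum>d\<in>UNIV. \<Sum>a\<in>UNIV. \<Sum>b\<in>UNIV. (cmod (W a b c d))\<^sup>2)"
    unfolding nsq_def by (intro sum_mono)
  also have "\<dots> = nsq4 W"
    unfolding nsq4_def by (rule sum_swap_pairs)
  finally show ?thesis .
qed

lemma nsq_nonneg4 [simp]: "0 \<le> nsq4 W"
  by (simp add: nsq4_def sum_nonneg)

text \<open>The remainder is estimated row by row in the standard basis. Row \<open>c\<close>
  carries the factor \<open>sqrt (1 - (cmod (u c))\<^sup>2)\<close>; as \<open>u\<close> is a unit
  vector, the squares of these factors add up to \<open>CARD('d) - 1\<close>.\<close>

lemma mean_field_bound:
  fixes W :: "'d::finite \<Rightarrow> 'd \<Rightarrow> 'd \<Rightarrow> 'd \<Rightarrow> complex"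
  assumes W: "\<And>a b c d. W a b c d = cnj (W c d a b)"
    and h: "\<And>u. nsq UNIV u = 1 \<Longrightarrow> hartree W u \<le> h" and "symmetric_fn \<phi>"
  shows "Re (pair_form n W \<phi> \<phi>)
    \<le> (h + sqrt (nsq4 W) * sqrt (real CARD('d) - 1) / (real n + 1)) * nsq (words (n + 2)) \<phi>"
proof -
  obtain L u M where u: "nsq UNIV u = 1"
    and le: "\<And>\<phi>. symmetric_fn \<phi> \<Longrightarrow> Re (pair_form n W \<phi> \<phi>) \<le> L * nsq (words (n + 2)) \<phi>"
    and L: "L = hartree W (\<lambda>x. cnj (u x))
       + Re (\<Sum>c\<in>UNIV. \<Sum>d\<in>UNIV. (\<Sum>a\<in>UNIV. \<Sum>b\<in>UNIV. u a * u b * W a b c d) * M c d)"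
    and M: "\<And>v w. cmod (bil M v w)
       \<le> 1 / (real n + 1) * sqrt (nsq UNIV v - (cmod (ip UNIV u v))\<^sup>2) * sqrt (nsq UNIV w)"
    by (rule top_eigenvalue_mean_field[OF W, where n = n]) (rule that)
  define w where "w c d = (\<Sum>a\<in>UNIV. \<Sum>b\<in>UNIV. u a * u b * W a b c d)" for c d
  define e where "e c = (\<lambda>x. if x = c then 1 else 0 :: complex)" for c :: 'd
  have e: "nsq UNIV (e c) = 1" "ip UNIV u (e c) = cnj (u c)" for c
    by (simp_all add: nsq_def ip_def e_def if_distrib[of cmod] if_distrib[of "\<lambda>a. a\<^sup>2"] if_distrib[of "\<lambda>a. _ * a"] cong: if_cong)
  have row: "(\<Sum>d\<in>UNIV. w c d * M c d) = bil M (e c) (w c)" for c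
    by (simp add: bil_def e_def if_distrib[of "\<lambda>a. a * _"] if_distrib[of "sum _"] sum.If_cases cong: if_cong)
  have u1: "(cmod (u c))\<^sup>2 \<le> 1" for c
  proof -
    have "(cmod (u c))\<^sup>2 \<le> nsq UNIV u"
      unfolding nsq_def by (rule member_le_sum) auto
    then show ?thesis by (simp add: u)
  qed
  have "cmod (\<Sum>c\<in>UNIV. \<Sum>d\<in>UNIV. w c d * M c d)
      \<le> (\<Sum>c\<in>UNIV. 1 / (real n + 1) * (sqrt (1 - (cmod (u c))\<^sup>2) * sqrt (nsq UNIV (w c))))"
    unfolding row using M[of "e c" "w c" for c]
    by (intro order_trans[OF norm_sum] sum_mono) (simp add: e mult.assoc)
  also have "\<dots> = 1 / (real n + 1) * (\<Sum>c\<in>UNIV. sqrt (1 - (cmod (u c))\<^sup>2) * sqrt (nsq UNIV (w c)))"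
    by (rule sum_distrib_left[symmetric])
  also have "\<dots> \<le> 1 / (real n + 1) * (sqrt (\<Sum>c\<in>UNIV. 1 - (cmod (u c))\<^sup>2) * sqrt (\<Sum>c\<in>UNIV. nsq UNIV (w c)))"
    by (intro mult_left_mono sum_mult_le_sqrt) (auto simp: u1)
  also have "(\<Sum>c\<in>UNIV. 1 - (cmod (u c))\<^sup>2) = real CARD('d) - 1"
    using u by (simp add: nsq_def sum_subtractf)
  also have "1 / (real n + 1) * (sqrt (real CARD('d) - 1) * sqrt (\<Sum>c\<in>UNIV. nsq UNIV (w c)))
      \<le> 1 / (real n + 1) * (sqrt (real CARD('d) - 1) * sqrt (nsq4 W))"
    using nsq_contraction_le[OF u, of W] by (intro mult_left_mono) (auto simp: w_def[abs_def])
  finally have err: "Re (\<Sum>c\<in>UNIV. \<Sum>d\<in>UNIV. w c d * M c d) \<le> sqrt (nsq4 W) * sqrt (real CARD('d) - 1) / (real n + 1)"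
    using complex_Re_le_cmod[of "\<Sum>c\<in>UNIV. \<Sum>d\<in>UNIV. w c d * M c d"] by (simp add: mult.commute)
  have "hartree W (\<lambda>x. cnj (u x)) \<le> h"
    by (rule h) (use u in \<open>simp add: nsq_def\<close>)
  then have "L \<le> h + sqrt (nsq4 W) * sqrt (real CARD('d) - 1) / (real n + 1)"
    using err unfolding L w_def by simp
  then show ?thesis
    using le[OF assms(3)] by (meson mult_right_mono nsq_nonneg order_trans)
qed

text \<open>The argument of \<open>mean_field_bound\<close> with the \<open>k\<close> vectors of
  \<open>p\<close> in place of the standard basis. As \<open>u\<close> need not lie in their span,
  each residual norm is only bounded by 1, which gives \<open>k\<close> rather than
  \<open>k - 1\<close>.\<close>

lemma mean_field_bound_low_rank:
  fixes W :: "'d::finite \<Rightarrow> 'd \<Rightarrow> 'd \<Rightarrow> 'd \<Rightarrow> complex"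
  assumes W: "\<And>a b c d. W a b c d = cnj (W c d a b)"
    and h: "\<And>u. nsq UNIV u = 1 \<Longrightarrow> hartree W u \<le> h" and "symmetric_fn \<phi>"
    and p: "onsys k p" and Wp: "\<And>a b d. proj k p (\<lambda>c. W a b c d) = (\<lambda>c. W a b c d)"
  shows "Re (pair_form n W \<phi> \<phi>)
    \<le> (h + sqrt (nsq4 W) * sqrt (real k) / (real n + 1)) * nsq (words (n + 2)) \<phi>"
proof -
  obtain L u M where u: "nsq UNIV u = 1"
    and le: "\<And>\<phi>. symmetric_fn \<phi> \<Longrightarrow> Re (pair_form n W \<phi> \<phi>) \<le> L * nsq (words (n + 2)) \<phi>"
    and L: "L = hartree W (\<lambda>x. cnj (u x))
       + Re (\<Sum>c\<in>UNIV. \<Sum>d\<in>UNIV. (\<Sum>a\<in>UNIV. \<Sum>b\<in>UNIV. u a * u b * W a b c d) * M c d)"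
    and M: "\<And>v w. cmod (bil M v w)
       \<le> 1 / (real n + 1) * sqrt (nsq UNIV v - (cmod (ip UNIV u v))\<^sup>2) * sqrt (nsq UNIV w)"
    by (rule top_eigenvalue_mean_field[OF W, where n = n]) (rule that)
  define w where "w c d = (\<Sum>a\<in>UNIV. \<Sum>b\<in>UNIV. u a * u b * W a b c d)" for c d
  define r where "r i d = ip UNIV (p i) (\<lambda>c. w c d)" for i d
  have wp: "w c d = (\<Sum>i<k. r i d * p i c)" for c d
  proof -
    have "w c d = (\<Sum>a\<in>UNIV. \<Sum>b\<in>UNIV. u a * u b * proj k p (\<lambda>c. W a b c d) c)"
      unfolding w_def Wp ..
    also have "\<dots> = (\<Sum>i<k. (\<Sum>a\<in>UNIV. \<Sum>b\<in>UNIV. u a * u b * ip UNIV (p i) (\<lambda>c. W a b c d)) * p i c)"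
      unfolding proj_def sum_distrib_left sum_distrib_right
      by (subst sum.swap, subst sum.swap[of _ _ "{..<k}"]) (simp add: mult_ac)
    finally show ?thesis
      unfolding r_def w_def by (simp add: ip_sum_right ip_scale_right)
  qed
  have pn: "nsq UNIV (p i) = 1" if "i < k" for i
    using p that ip_self[of UNIV "p i"] unfolding onsys_def by (metis of_real_eq_1_iff)
  have "(\<Sum>c\<in>UNIV. \<Sum>d\<in>UNIV. w c d * M c d) = (\<Sum>i<k. bil M (p i) (r i))"
    unfolding wp bil_def sum_distrib_right
    by (subst sum.swap, subst sum.swap[of _ _ "{..<k}"]) (simp add: mult_ac)
  \<comment> \<open>The factor \<open>sqrt 1\<close> prepares for \<open>sum_mult_le_sqrt\<close>,
    which turns it into \<open>sqrt (real k)\<close>.\<close>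
  moreover have "cmod (bil M (p i) (r i)) \<le> 1 / (real n + 1) * (sqrt 1 * sqrt (nsq UNIV (r i)))" if "i < k" for i
  proof -
    have "cmod (bil M (p i) (r i)) \<le> 1 / (real n + 1) * sqrt (nsq UNIV (p i) - (cmod (ip UNIV u (p i)))\<^sup>2) * sqrt (nsq UNIV (r i))"
      by (rule M)
    also have "\<dots> \<le> 1 / (real n + 1) * sqrt 1 * sqrt (nsq UNIV (r i))"
      by (intro mult_right_mono mult_left_mono real_sqrt_le_mono) (auto simp: pn[OF that])
    finally show ?thesis by (simp only: mult.assoc)
  qed
  ultimately have "cmod (\<Sum>c\<in>UNIV. \<Sum>d\<in>UNIV. w c d * M c d)
      \<le> (\<Sum>i<k. 1 / (real n + 1) * (sqrt 1 * sqrt (nsq UNIV (r i))))"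
    by (simp only:) (intro order_trans[OF norm_sum] sum_mono, auto)
  also have "\<dots> = 1 / (real n + 1) * (\<Sum>i<k. sqrt 1 * sqrt (nsq UNIV (r i)))"
    by (rule sum_distrib_left[symmetric])
  also have "\<dots> \<le> 1 / (real n + 1) * (sqrt (\<Sum>i<k. 1) * sqrt (\<Sum>i<k. nsq UNIV (r i)))"
    by (intro mult_left_mono sum_mult_le_sqrt) auto
  also have "\<dots> \<le> 1 / (real n + 1) * (sqrt (real k) * sqrt (nsq4 W))"
  proof -
    have "(\<Sum>i<k. nsq UNIV (r i)) \<le> (\<Sum>c\<in>UNIV. nsq UNIV (w c))"
      unfolding r_def by (rule bessel_family[OF p])
    also have "\<dots> \<le> nsq4 W"
      using nsq_contraction_le[OF u, of W] by (simp add: w_def[abs_def])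
    finally show ?thesis
      by (intro mult_left_mono mult_mono) (auto intro: sum_nonneg)
  qed
  finally have err: "Re (\<Sum>c\<in>UNIV. \<Sum>d\<in>UNIV. w c d * M c d) \<le> sqrt (nsq4 W) * sqrt (real k) / (real n + 1)"
    using complex_Re_le_cmod[of "\<Sum>c\<in>UNIV. \<Sum>d\<in>UNIV. w c d * M c d"] by (simp add: mult.commute)
  have "hartree W (\<lambda>x. cnj (u x)) \<le> h"
    by (rule h) (use u in \<open>simp add: nsq_def\<close>)
  then have "L \<le> h + sqrt (nsq4 W) * sqrt (real k) / (real n + 1)"
    using err unfolding L w_def by simp
  then show ?thesis
    using le[OF assms(3)] by (meson mult_right_mono nsq_nonneg order_trans)
qed

subsection \<open>Creation, annihilation and low occupation numbers\<close>

text \<open>The unnormalised bosonic creation operator: \<open>f\<close> is inserted at every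
  position and the results are added. \<open>annihilation\<close> is unnormalised as well, so the
  two are adjoint only up to the number of factors.\<close>

fun creation :: "('d \<Rightarrow> complex) \<Rightarrow> ('d list \<Rightarrow> complex) \<Rightarrow> 'd list \<Rightarrow> complex" where
  "creation f \<phi> [] = 0"
| "creation f \<phi> (x # xs) = f x * \<phi> xs + creation f (\<lambda>zs. \<phi> (x # zs)) xs"

definition annihilation :: "('d::finite \<Rightarrow> complex) \<Rightarrow> ('d list \<Rightarrow> complex) \<Rightarrow> 'd list \<Rightarrow> complex" where
  "annihilation f \<phi> = (\<lambda>xs. ip UNIV f (\<lambda>x. \<phi> (x # xs)))"

lemma ip_words_Suc:
  "ip (words (Suc n)) f g = (\<Sum>x\<in>UNIV. ip (words n) (\<lambda>xs. f (x # xs)) (\<lambda>xs. g (x # xs)))"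
  for f :: "'d::finite list \<Rightarrow> complex"
  by (simp add: ip_def sum_words_Suc)

lemma nsq_words_Suc: "nsq (words (Suc n)) f = (\<Sum>x\<in>UNIV. nsq (words n) (\<lambda>xs. f (x # xs)))"
  for f :: "'d::finite list \<Rightarrow> complex"
  by (simp add: nsq_def sum_words_Suc)

lemma symmetric_fn_annihilation: "symmetric_fn \<phi> \<Longrightarrow> symmetric_fn (annihilation f \<phi>)"
  unfolding annihilation_def ip_def
  by (rule symmetric_fn_sum) (rule symmetric_fn_Cons)

lemma annihilation_Cons:
  "symmetric_fn \<phi> \<Longrightarrow> annihilation f \<phi> (x # xs) = annihilation f (\<lambda>zs. \<phi> (x # zs)) xs"
  unfolding annihilation_def by (subst symmetric_fn_Cons2) simp_all

lemma ip_annihilation_left: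
  "ip (words n) (annihilation f \<eta>) \<phi> = (\<Sum>x\<in>UNIV. f x * ip (words n) (\<lambda>xs. \<eta> (x # xs)) \<phi>)"
  unfolding annihilation_def ip_def cnj_sum sum_distrib_left sum_distrib_right
  by (subst sum.swap) (simp add: mult_ac)

text \<open>Each of the \<open>n + 1\<close> insertion positions contributes the same amount,
  because \<open>\<eta>\<close> is symmetric.\<close>

lemma ip_creation:
  fixes \<eta> :: "'d::finite list \<Rightarrow> complex"
  assumes "symmetric_fn \<eta>"
  shows "ip (words (Suc n)) \<eta> (creation f \<phi>) = of_nat (Suc n) * ip (words n) (annihilation f \<eta>) \<phi>"
  using assms
proof (induction n arbitrary: \<eta> \<phi>)
  case 0
  show ?case
    unfolding ip_words_Suc ip_annihilation_left by (simp add: ip_def mult_ac)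
next
  case (Suc n)
  have "ip (words (Suc (Suc n))) \<eta> (creation f \<phi>)
      = (\<Sum>x\<in>UNIV. f x * ip (words (Suc n)) (\<lambda>xs. \<eta> (x # xs)) \<phi>)
      + (\<Sum>x\<in>UNIV. ip (words (Suc n)) (\<lambda>xs. \<eta> (x # xs)) (creation f (\<lambda>zs. \<phi> (x # zs))))"
    unfolding ip_words_Suc[of "Suc n"] by (simp only: creation.simps ip_add_right ip_scale_right sum.distrib)
  also have "(\<Sum>x\<in>UNIV. f x * ip (words (Suc n)) (\<lambda>xs. \<eta> (x # xs)) \<phi>)
      = ip (words (Suc n)) (annihilation f \<eta>) \<phi>"
    by (rule ip_annihilation_left[symmetric])
  also have "(\<Sum>x\<in>UNIV. ip (words (Suc n)) (\<lambda>xs. \<eta> (x # xs)) (creation f (\<lambda>zs. \<phi> (x # zs))))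
      = (\<Sum>x\<in>UNIV. of_nat (Suc n) * ip (words n) (annihilation f (\<lambda>xs. \<eta> (x # xs))) (\<lambda>zs. \<phi> (x # zs)))"
    by (intro sum.cong refl Suc.IH symmetric_fn_Cons Suc.prems)
  also have "\<dots> = of_nat (Suc n) * ip (words (Suc n)) (annihilation f \<eta>) \<phi>"
    unfolding ip_words_Suc[of n] annihilation_Cons[OF Suc.prems] by (rule sum_distrib_left[symmetric])
  finally show ?case
    by (simp add: distrib_right)
qed

text \<open>The canonical commutation relation in the unnormalised convention. The squared terms
  supply one multiple of the norm, and the cross terms become annihilation norms by
  \<open>ip_creation\<close>.\<close>

lemma nsq_creation:
  fixes \<phi> :: "'d::finite list \<Rightarrow> complex"
  assumes "symmetric_fn \<phi>"
  shows "nsq (words (Suc n)) (creation f \<phi>)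
    = real (Suc n) * (nsq UNIV f * nsq (words n) \<phi> + real n * nsq (words (n - 1)) (annihilation f \<phi>))"
  using assms
proof (induction n arbitrary: \<phi>)
  case 0
  show ?case
    unfolding nsq_words_Suc
    by (simp add: nsq_def norm_mult power_mult_distrib sum_distrib_right)
next
  case (Suc n)
  define A where "A = nsq (words n) (annihilation f \<phi>)"
  define B where "B = nsq UNIV f * nsq (words (Suc n)) \<phi>"
  have "nsq (words (Suc (Suc n))) (creation f \<phi>)
      = (\<Sum>x\<in>UNIV. (cmod (f x))\<^sup>2 * nsq (words (Suc n)) \<phi>
          + 2 * Re (cnj (f x) * ip (words (Suc n)) \<phi> (creation f (\<lambda>zs. \<phi> (x # zs))))
          + nsq (words (Suc n)) (creation f (\<lambda>zs. \<phi> (x # zs))))"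
    unfolding nsq_words_Suc[of "Suc n"] by (simp only: creation.simps nsq_add nsq_scale ip_scale_left)
  also have "\<dots> = (\<Sum>x\<in>UNIV. (cmod (f x))\<^sup>2 * nsq (words (Suc n)) \<phi>)
      + 2 * Re (\<Sum>x\<in>UNIV. cnj (f x) * ip (words (Suc n)) \<phi> (creation f (\<lambda>zs. \<phi> (x # zs))))
      + (\<Sum>x\<in>UNIV. nsq (words (Suc n)) (creation f (\<lambda>zs. \<phi> (x # zs))))"
    by (simp only: sum.distrib Re_sum sum_distrib_left)
  also have "(\<Sum>x\<in>UNIV. (cmod (f x))\<^sup>2 * nsq (words (Suc n)) \<phi>) = B"
    unfolding B_def nsq_def by (rule sum_distrib_right[symmetric])
  also have "(\<Sum>x\<in>UNIV. cnj (f x) * ip (words (Suc n)) \<phi> (creation f (\<lambda>zs. \<phi> (x # zs))))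
      = of_nat (Suc n) * of_real A"
  proof -
    have "(\<Sum>x\<in>UNIV. cnj (f x) * ip (words (Suc n)) \<phi> (creation f (\<lambda>zs. \<phi> (x # zs))))
      = of_nat (Suc n) * (\<Sum>x\<in>UNIV. cnj (f x) * ip (words n) (annihilation f \<phi>) (\<lambda>zs. \<phi> (x # zs)))"
      unfolding ip_creation[OF Suc.prems] by (simp add: sum_distrib_left mult_ac)
    also have "(\<Sum>x\<in>UNIV. cnj (f x) * ip (words n) (annihilation f \<phi>) (\<lambda>zs. \<phi> (x # zs)))
      = ip (words n) (annihilation f \<phi>) (annihilation f \<phi>)"
      unfolding annihilation_def[of f \<phi>]
      unfolding ip_def[of UNIV f] by (simp only: ip_sum_right ip_scale_right)
    finally show ?thesis by (simp add: ip_self A_def)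
  qed
  also have "(\<Sum>x\<in>UNIV. nsq (words (Suc n)) (creation f (\<lambda>zs. \<phi> (x # zs))))
      = (\<Sum>x\<in>UNIV. real (Suc n) * (nsq UNIV f * nsq (words n) (\<lambda>zs. \<phi> (x # zs))
          + real n * nsq (words (n - 1)) (annihilation f (\<lambda>zs. \<phi> (x # zs)))))"
    by (intro sum.cong refl Suc.IH symmetric_fn_Cons Suc.prems)
  also have "\<dots> = real (Suc n) * (B + real n * (\<Sum>x\<in>UNIV. nsq (words (n - 1)) (annihilation f (\<lambda>zs. \<phi> (x # zs)))))"
    unfolding B_def nsq_words_Suc[of n] by (simp only: sum_distrib_left[symmetric] sum.distrib)
  also have "real n * (\<Sum>x\<in>UNIV. nsq (words (n - 1)) (annihilation f (\<lambda>zs. \<phi> (x # zs)))) = real n * A"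
  \<comment> \<open>For \<open>n = 0\<close> the prefactor removes both sides, so the truncated
    \<open>n - 1\<close> does no harm.\<close>
  proof (cases n)
    case (Suc m)
    then show ?thesis
      unfolding A_def by (simp add: nsq_words_Suc annihilation_Cons[OF Suc.prems])
  qed simp
  finally show ?case
    by (simp add: A_def[symmetric] B_def[symmetric] algebra_simps)
qed

text \<open>Moving the annihilation operator to the other side as a creation operator before
  applying Cauchy-Schwarz gains a factor \<open>1 / sqrt (n + 1)\<close> whenever the occupation of
  \<open>f\<close> in \<open>\<phi>\<close> is of order \<open>1 / n\<close>.\<close>

lemma ip_annihilation_bound:
  fixes \<phi> \<eta> :: "'d::finite list \<Rightarrow> complex"
  assumes "symmetric_fn \<phi>" "symmetric_fn \<eta>"
  shows "cmod (ip (words n) (annihilation f \<eta>) \<phi>) \<le> sqrt (nsq (words (Suc n)) \<eta>)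
    * sqrt ((nsq UNIV f * nsq (words n) \<phi> + real n * nsq (words (n - 1)) (annihilation f \<phi>)) / real (Suc n))"
proof -
  define C where "C = nsq UNIV f * nsq (words n) \<phi> + real n * nsq (words (n - 1)) (annihilation f \<phi>)"
  have "real (Suc n) * cmod (ip (words n) (annihilation f \<eta>) \<phi>) = cmod (ip (words (Suc n)) \<eta> (creation f \<phi>))"
    unfolding ip_creation[OF assms(2)] norm_mult norm_of_nat ..
  also have "\<dots> \<le> sqrt (nsq (words (Suc n)) \<eta>) * sqrt (real (Suc n) * C)"
    unfolding C_def nsq_creation[OF assms(1), symmetric] by (rule cauchy_schwarz)
  also have "sqrt (real (Suc n) * C) = real (Suc n) * sqrt (C / real (Suc n))"
    by (simp add: real_sqrt_mult real_sqrt_divide real_div_sqrt flip: times_divide_eq_left)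
  finally have "real (Suc n) * cmod (ip (words n) (annihilation f \<eta>) \<phi>)
      \<le> real (Suc n) * (sqrt (nsq (words (Suc n)) \<eta>) * sqrt (C / real (Suc n)))"
    by (simp only: mult.left_commute)
  then show ?thesis
    unfolding C_def by (rule mult_left_le_imp_le) simp
qed

text \<open>
  The part of \<open>X\<close> whose second index meets the directions heavily occupied by \<open>\<phi>\<close> is
  controlled by the low occupation of its first index in \<open>\<psi>\<close>; for the rest, symmetrisation
  over the last \<open>n + 1\<close> factors gains the factor \<open>1 / sqrt (n + 1)\<close>.
\<close>

lemma low_occupation_overlap:
  fixes \<psi> \<phi> :: "'d::finite list \<Rightarrow> complex"
  assumes \<psi>: "symmetric_fn \<psi>" "nsq (words (Suc (Suc n))) \<psi> = 1" and \<phi>: "symmetric_fn \<phi>"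
    and low: "\<And>q. (\<And>i. i < k \<Longrightarrow> ip UNIV (p i) q = 0)
        \<Longrightarrow> nsq (words (Suc n)) (annihilation q \<psi>) \<le> nsq UNIV q / real (Suc n)"
    and X: "\<And>i b. i < k \<Longrightarrow> ip UNIV (p i) (\<lambda>a. X a b) = 0"
  shows "cmod (\<Sum>a\<in>UNIV. \<Sum>b\<in>UNIV. X a b * ip (words n) (\<lambda>zs. \<psi> (a # b # zs)) \<phi>)
    \<le> 2 * sqrt 2 / sqrt (real (Suc n)) * sqrt (\<Sum>a\<in>UNIV. nsq UNIV (X a)) * sqrt (nsq (words n) \<phi>)"
\<comment> \<open>Without a factor left in \<open>\<phi>\<close> no directions can be selected.
  There plain Cauchy-Schwarz suffices, because the constant exceeds 1 at
  \<open>n = 0\<close>.\<close>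
proof (cases "n = 0 \<or> nsq (words n) \<phi> = 0")
  case True
  define c where "c = 2 * sqrt 2 / sqrt (real (Suc n))"
  have "cmod (\<Sum>a\<in>UNIV. \<Sum>b\<in>UNIV. X a b * ip (words n) (\<lambda>zs. \<psi> (a # b # zs)) \<phi>)
      \<le> sqrt (\<Sum>a\<in>UNIV. nsq UNIV (X a)) * sqrt (nsq (words n) \<phi>)"
  proof -
    have "cmod (\<Sum>b\<in>UNIV. X a b * ip (words n) (\<lambda>zs. \<psi> (a # b # zs)) \<phi>)
        \<le> sqrt (nsq UNIV (X a)) * (sqrt (nsq (words (Suc n)) (\<lambda>zs. \<psi> (a # zs))) * sqrt (nsq (words n) \<phi>))" for a
    proof -
      have "cmod (\<Sum>b\<in>UNIV. X a b * ip (words n) (\<lambda>zs. \<psi> (a # b # zs)) \<phi>)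
          \<le> (\<Sum>b\<in>UNIV. cmod (X a b) * (sqrt (nsq (words n) (\<lambda>zs. \<psi> (a # b # zs))) * sqrt (nsq (words n) \<phi>)))"
        by (intro sum_norm_le) (simp add: norm_mult mult_left_mono cauchy_schwarz)
      also have "\<dots> = (\<Sum>b\<in>UNIV. sqrt ((cmod (X a b))\<^sup>2) * sqrt (nsq (words n) (\<lambda>zs. \<psi> (a # b # zs)))) * sqrt (nsq (words n) \<phi>)"
        by (simp add: sum_distrib_right mult.assoc)
      also have "\<dots> \<le> (sqrt (nsq UNIV (X a)) * sqrt (nsq (words (Suc n)) (\<lambda>zs. \<psi> (a # zs)))) * sqrt (nsq (words n) \<phi>)"
        unfolding nsq_words_Suc nsq_def[of UNIV "X a"]
        by (intro mult_right_mono sum_mult_le_sqrt) auto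
      finally show ?thesis by (simp only: mult.assoc)
    qed
    then have "cmod (\<Sum>a\<in>UNIV. \<Sum>b\<in>UNIV. X a b * ip (words n) (\<lambda>zs. \<psi> (a # b # zs)) \<phi>)
        \<le> (\<Sum>a\<in>UNIV. sqrt (nsq UNIV (X a)) * (sqrt (nsq (words (Suc n)) (\<lambda>zs. \<psi> (a # zs))) * sqrt (nsq (words n) \<phi>)))"
      by (intro sum_norm_le)
    also have "\<dots> = (\<Sum>a\<in>UNIV. sqrt (nsq UNIV (X a)) * sqrt (nsq (words (Suc n)) (\<lambda>zs. \<psi> (a # zs)))) * sqrt (nsq (words n) \<phi>)"
      by (simp add: sum_distrib_right mult.assoc)
    also have "\<dots> \<le> (sqrt (\<Sum>a\<in>UNIV. nsq UNIV (X a)) * sqrt (nsq (words (Suc (Suc n))) \<psi>)) * sqrt (nsq (words n) \<phi>)"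
      unfolding nsq_words_Suc[of "Suc n" \<psi>]
      by (intro mult_right_mono sum_mult_le_sqrt) auto
    finally show ?thesis by (simp add: \<psi>(2))
  qed
  also have "\<dots> \<le> c * (sqrt (\<Sum>a\<in>UNIV. nsq UNIV (X a)) * sqrt (nsq (words n) \<phi>))"
  proof (cases "n = 0")
    case True
    then have "c = 2 * sqrt 2" by (simp add: c_def)
    moreover have "1 \<le> sqrt 2" by simp
    ultimately have "1 \<le> c" by linarith
    then show ?thesis
      by (intro mult_right_mono[of 1 c, simplified] mult_nonneg_nonneg) (auto intro: sum_nonneg)
  next
    case False
    with True show ?thesis by simp
  qed
  finally show ?thesis by (simp only: c_def mult.assoc)
next
  case False
  define F where "F = nsq (words n) \<phi>"
  \<comment> \<open>This threshold leaves at most \<open>n + 1\<close> heavy directions, while the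
    light ones satisfy \<open>n * t \<le> F\<close>.\<close>
  define t where "t = F / real (Suc n)"
  define Z where "Z = (\<Sum>a\<in>UNIV. nsq UNIV (X a))"
  have "F \<noteq> 0" "0 \<le> F" using False by (simp_all add: F_def)
  then have "0 < F" by linarith
  then have "0 < t" by (simp add: t_def)
  have Z0: "0 \<le> Z" by (simp add: Z_def sum_nonneg)
  have Fsum: "(\<Sum>x\<in>UNIV. nsq (words (n - 1)) (\<lambda>zs. \<phi> (x # zs))) = F"
    using False nsq_words_Suc[of "n - 1" \<phi>] by (simp add: F_def)
  obtain l g where g: "onsys l g" and lt: "real l * t \<le> F"
    and lowg: "\<And>q. (\<And>i. i < l \<Longrightarrow> ip UNIV (g i) q = 0)
      \<Longrightarrow> nsq (words (n - 1)) (\<lambda>zs. ip UNIV q (\<lambda>x. \<phi> (x # zs))) \<le> t * nsq UNIV q"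
    by (rule greedy_onsys[OF \<open>0 < t\<close>, of "words (n - 1)" "\<lambda>x zs. \<phi> (x # zs)", unfolded Fsum]) (erule that, assumption, blast)
  note lowg = lowg[folded annihilation_def]
  from lt have "F * real l \<le> F * real (Suc n)"
    by (simp add: t_def field_simps)
  then have l: "real l \<le> real (Suc n)"
    using \<open>0 < F\<close> by (rule mult_left_le_imp_le)
  define A where "A f a = ip (words n) (annihilation f (\<lambda>zs. \<psi> (a # zs))) \<phi>" for f a
  have A: "A f a = (\<Sum>b\<in>UNIV. f b * ip (words n) (\<lambda>zs. \<psi> (a # b # zs)) \<phi>)" for f a
    unfolding A_def by (rule ip_annihilation_left)
  \<comment> \<open>The second index of \<open>X\<close> is split into its heavy part, with
    coefficient vectors \<open>q j\<close>, and the light remainder \<open>r\<close>.\<close>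
  define r where "r a = (\<lambda>b. X a b - proj l g (X a) b)" for a
  define q where "q j a = ip UNIV (g j) (X a)" for j a
  have split: "A (X a) a = A (r a) a + (\<Sum>j<l. q j a * A (g j) a)" for a
  proof -
    have "(\<Sum>j<l. q j a * A (g j) a) = A (proj l g (X a)) a"
      unfolding A proj_def q_def sum_distrib_left sum_distrib_right
      by (subst sum.swap) (simp add: mult_ac)
    moreover have "A (X a) a = A (r a) a + A (proj l g (X a)) a"
      by (simp add: A r_def sum.distrib[symmetric] left_diff_distrib)
    ultimately show ?thesis by simp
  qed
  \<comment> \<open>On light directions both terms of \<open>ip_annihilation_bound\<close> are at
    most \<open>F * nsq UNIV (r a)\<close>, whence the constant 2.\<close>
  have part1: "cmod (\<Sum>a\<in>UNIV. A (r a) a) \<le> sqrt (2 * F / real (Suc n)) * sqrt Z"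
  proof -
    have "cmod (A (r a) a) \<le> sqrt (2 * F / real (Suc n)) * (sqrt (nsq (words (Suc n)) (\<lambda>zs. \<psi> (a # zs))) * sqrt (nsq UNIV (X a)))" for a
    proof -
      have "ip UNIV (g i) (r a) = 0" if "i < l" for i
        unfolding r_def ip_diff_right ip_onsys_proj[OF g that] by simp
      then have "real n * nsq (words (n - 1)) (annihilation (r a) \<phi>) \<le> real n * (t * nsq UNIV (r a))"
        by (intro mult_left_mono lowg) auto
      also have "\<dots> = (real n * t) * nsq UNIV (r a)" by simp
      also have "\<dots> \<le> F * nsq UNIV (r a)"
        using \<open>0 < F\<close> by (intro mult_right_mono) (auto simp: t_def field_simps)
      finally have "(nsq UNIV (r a) * nsq (words n) \<phi> + real n * nsq (words (n - 1)) (annihilation (r a) \<phi>)) / real (Suc n)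
          \<le> (nsq UNIV (r a) * F + F * nsq UNIV (r a)) / real (Suc n)"
        by (intro divide_right_mono) (auto simp: F_def mult.commute)
      also have "\<dots> = 2 * F / real (Suc n) * nsq UNIV (r a)"
        by (simp add: field_simps)
      also have "\<dots> \<le> 2 * F / real (Suc n) * nsq UNIV (X a)"
        using \<open>0 < F\<close> nsq_minus_proj[OF g, of "X a"] by (intro mult_left_mono) (auto simp: r_def)
      finally have *: "sqrt ((nsq UNIV (r a) * nsq (words n) \<phi> + real n * nsq (words (n - 1)) (annihilation (r a) \<phi>)) / real (Suc n))
          \<le> sqrt (2 * F / real (Suc n)) * sqrt (nsq UNIV (X a))"
        by (simp only: real_sqrt_mult[symmetric] real_sqrt_le_iff)
      have "cmod (A (r a) a) \<le> sqrt (nsq (words (Suc n)) (\<lambda>zs. \<psi> (a # zs)))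
          * (sqrt (2 * F / real (Suc n)) * sqrt (nsq UNIV (X a)))"
        unfolding A_def
        by (intro order_trans[OF ip_annihilation_bound[OF \<phi> symmetric_fn_Cons[OF \<psi>(1)]]] mult_left_mono *) auto
      then show ?thesis by (simp only: mult_ac)
    qed
    then have "cmod (\<Sum>a\<in>UNIV. A (r a) a) \<le> (\<Sum>a\<in>UNIV. sqrt (2 * F / real (Suc n)) * (sqrt (nsq (words (Suc n)) (\<lambda>zs. \<psi> (a # zs))) * sqrt (nsq UNIV (X a))))"
      by (intro sum_norm_le)
    also have "\<dots> = sqrt (2 * F / real (Suc n)) * (\<Sum>a\<in>UNIV. sqrt (nsq (words (Suc n)) (\<lambda>zs. \<psi> (a # zs))) * sqrt (nsq UNIV (X a)))"
      by (rule sum_distrib_left[symmetric])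
    also have "\<dots> \<le> sqrt (2 * F / real (Suc n)) * (sqrt (nsq (words (Suc (Suc n))) \<psi>) * sqrt Z)"
      unfolding Z_def nsq_words_Suc[of "Suc n" \<psi>] using \<open>0 < F\<close>
      by (intro mult_left_mono sum_mult_le_sqrt) auto
    finally show ?thesis by (simp add: \<psi>(2))
  qed
  \<comment> \<open>The first index is contracted first. Each \<open>q j\<close> is orthogonal to
    the system \<open>p\<close>, so its occupation in \<open>\<psi>\<close> is low. The other
    factors are summed by Bessel's inequality together with \<open>l \<le> n + 1\<close>.\<close>
  have part2: "cmod (\<Sum>a\<in>UNIV. \<Sum>j<l. q j a * A (g j) a) \<le> sqrt (2 * F / real (Suc n)) * sqrt Z"
  proof -
    have gn: "nsq UNIV (g j) = 1" if "j < l" for j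
      using g that ip_self[of UNIV "g j"] unfolding onsys_def by (metis of_real_eq_1_iff)
    have eq: "(\<Sum>a\<in>UNIV. q j a * A (g j) a) = ip (words n) (annihilation (g j) (annihilation (q j) \<psi>)) \<phi>" for j
    proof -
      have "ip (words n) (annihilation (g j) (annihilation (q j) \<psi>)) \<phi>
          = (\<Sum>b\<in>UNIV. g j b * ip (words n) (annihilation (q j) (\<lambda>zs. \<psi> (b # zs))) \<phi>)"
        unfolding ip_annihilation_left[of _ "g j"] annihilation_Cons[OF \<psi>(1)] ..
      also have "\<dots> = (\<Sum>b\<in>UNIV. \<Sum>a\<in>UNIV. q j a * (g j b * ip (words n) (\<lambda>zs. \<psi> (b # a # zs)) \<phi>))"
        unfolding ip_annihilation_left[of _ "q j"] by (simp add: sum_distrib_left mult_ac)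
      also have "\<dots> = (\<Sum>a\<in>UNIV. \<Sum>b\<in>UNIV. q j a * (g j b * ip (words n) (\<lambda>zs. \<psi> (a # b # zs)) \<phi>))"
        by (subst sum.swap) (simp add: symmetric_fn_Cons2[OF \<psi>(1)])
      finally show ?thesis
        by (simp add: A sum_distrib_left)
    qed
    have one: "cmod (\<Sum>a\<in>UNIV. q j a * A (g j) a)
        \<le> sqrt (nsq UNIV (q j) / real (Suc n)) * sqrt ((F + real n * nsq (words (n - 1)) (annihilation (g j) \<phi>)) / real (Suc n))"
      if "j < l" for j
    proof -
      have "ip UNIV (p i) (q j) = 0" if "i < k" for i
      proof -
        have "ip UNIV (p i) (q j) = ip UNIV (p i) (\<lambda>a. \<Sum>b\<in>UNIV. cnj (g j b) * X a b)"
          unfolding q_def ip_def[of _ "g j"] ..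
        also have "\<dots> = 0"
          unfolding ip_sum_right ip_scale_right X[OF that] by simp
        finally show ?thesis .
      qed
      then have "nsq (words (Suc n)) (annihilation (q j) \<psi>) \<le> nsq UNIV (q j) / real (Suc n)"
        by (rule low)
      then have "sqrt (nsq (words (Suc n)) (annihilation (q j) \<psi>)) \<le> sqrt (nsq UNIV (q j) / real (Suc n))"
        by (rule real_sqrt_le_mono)
      moreover have "cmod (ip (words n) (annihilation (g j) (annihilation (q j) \<psi>)) \<phi>)
         \<le> sqrt (nsq (words (Suc n)) (annihilation (q j) \<psi>)) * sqrt ((F + real n * nsq (words (n - 1)) (annihilation (g j) \<phi>)) / real (Suc n))"
        using ip_annihilation_bound[OF \<phi> symmetric_fn_annihilation[OF \<psi>(1)], of n "g j" "q j"] gn[OF \<open>j < l\<close>]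
        by (simp add: F_def)
      ultimately show ?thesis
        unfolding eq using \<open>0 < F\<close>
        by (elim order_trans) (intro mult_right_mono, auto)
    qed
    have "(\<Sum>a\<in>UNIV. \<Sum>j<l. q j a * A (g j) a) = (\<Sum>j<l. \<Sum>a\<in>UNIV. q j a * A (g j) a)"
      by (rule sum.swap)
    then have "cmod (\<Sum>a\<in>UNIV. \<Sum>j<l. q j a * A (g j) a)
       \<le> (\<Sum>j<l. sqrt (nsq UNIV (q j) / real (Suc n)) * sqrt ((F + real n * nsq (words (n - 1)) (annihilation (g j) \<phi>)) / real (Suc n)))"
      by (simp only:) (intro sum_norm_le one, auto)
    also have "\<dots> \<le> sqrt (\<Sum>j<l. nsq UNIV (q j) / real (Suc n)) * sqrt (\<Sum>j<l. (F + real n * nsq (words (n - 1)) (annihilation (g j) \<phi>)) / real (Suc n))"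
      using \<open>0 < F\<close> by (intro sum_mult_le_sqrt) auto
    also have "\<dots> \<le> sqrt (Z / real (Suc n)) * sqrt (2 * F)"
    proof (intro mult_mono real_sqrt_le_mono)
      have "(\<Sum>j<l. nsq UNIV (q j)) \<le> (\<Sum>b\<in>UNIV. nsq UNIV (\<lambda>a. X a b))"
        unfolding q_def using bessel_family[OF g, of UNIV "\<lambda>b a. X a b"] by simp
      also have "\<dots> = Z"
        unfolding Z_def nsq_def by (rule sum.swap)
      finally show "(\<Sum>j<l. nsq UNIV (q j) / real (Suc n)) \<le> Z / real (Suc n)"
        by (simp add: divide_right_mono flip: sum_divide_distrib)
      have "(\<Sum>j<l. nsq (words (n - 1)) (annihilation (g j) \<phi>)) \<le> F"
        unfolding annihilation_def Fsum[symmetric] by (rule bessel_family[OF g])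
      then have "real n * (\<Sum>j<l. nsq (words (n - 1)) (annihilation (g j) \<phi>)) \<le> real (Suc n) * F"
        using \<open>0 < F\<close> by (intro mult_mono) (auto intro: sum_nonneg)
      moreover have "real l * F \<le> real (Suc n) * F"
        using l \<open>0 < F\<close> by (intro mult_right_mono) auto
      ultimately have "(\<Sum>j<l. F + real n * nsq (words (n - 1)) (annihilation (g j) \<phi>)) \<le> real (Suc n) * (2 * F)"
        by (simp add: sum.distrib sum_distrib_left)
      then show "(\<Sum>j<l. (F + real n * nsq (words (n - 1)) (annihilation (g j) \<phi>)) / real (Suc n)) \<le> 2 * F"
        unfolding sum_divide_distrib[symmetric] by (simp add: divide_le_eq mult.commute)
    qed (use Z0 \<open>0 < F\<close> in \<open>auto intro!: sum_nonneg divide_nonneg_nonneg add_nonneg_nonneg\<close>)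
    also have "\<dots> = sqrt (2 * F / real (Suc n)) * sqrt Z"
      by (simp add: real_sqrt_mult[symmetric])
    finally show ?thesis .
  qed
  have "(\<Sum>a\<in>UNIV. \<Sum>b\<in>UNIV. X a b * ip (words n) (\<lambda>zs. \<psi> (a # b # zs)) \<phi>)
      = (\<Sum>a\<in>UNIV. A (r a) a) + (\<Sum>a\<in>UNIV. \<Sum>j<l. q j a * A (g j) a)"
    unfolding A[symmetric] split sum.distrib ..
  then have "cmod (\<Sum>a\<in>UNIV. \<Sum>b\<in>UNIV. X a b * ip (words n) (\<lambda>zs. \<psi> (a # b # zs)) \<phi>)
      \<le> 2 * (sqrt (2 * F / real (Suc n)) * sqrt Z)"
    using part1 part2 by (simp only:) (intro order_trans[OF norm_triangle_ineq], linarith)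
  then show ?thesis
    unfolding F_def Z_def by (simp add: real_sqrt_mult real_sqrt_divide mult_ac)
qed

lemma pair_form_diff:
  "pair_form n (\<lambda>a b c d. V a b c d - W a b c d) \<phi> \<psi> = pair_form n V \<phi> \<psi> - pair_form n W \<phi> \<psi>"
  by (simp add: pair_form_def left_diff_distrib right_diff_distrib sum_subtractf)

text \<open>For each pair of column indices, \<open>low_occupation_overlap\<close> is applied to
  \<open>\<psi>\<close> with its first two entries fixed. Cauchy-Schwarz over the pairs then
  reassembles the norm of \<open>R\<close> and that of \<open>\<psi>\<close>.\<close>

lemma low_occupation_form:
  fixes \<psi> :: "'d::finite list \<Rightarrow> complex"
  assumes \<psi>: "symmetric_fn \<psi>" "nsq (words (Suc (Suc n))) \<psi> = 1"
    and low: "\<And>q. (\<And>i. i < k \<Longrightarrow> ip UNIV (p i) q = 0)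
        \<Longrightarrow> nsq (words (Suc n)) (annihilation q \<psi>) \<le> nsq UNIV q / real (Suc n)"
    and R: "\<And>i b c d. i < k \<Longrightarrow> ip UNIV (p i) (\<lambda>a. R a b c d) = 0"
  shows "cmod (pair_form n R \<psi> \<psi>) \<le> 2 * sqrt 2 / sqrt (real (Suc n)) * sqrt (nsq4 R)"
proof -
  define e where "e = 2 * sqrt 2 / sqrt (real (Suc n))"
  define X where "X c d = (\<Sum>a\<in>UNIV. nsq UNIV (\<lambda>b. R a b c d))" for c d
  define F where "F c d = nsq (words n) (\<lambda>zs. \<psi> (c # d # zs))" for c d
  have pos: "0 \<le> X c d" "0 \<le> F c d" for c d
    by (simp_all add: X_def F_def sum_nonneg)
  have "pair_form n R \<psi> \<psi> = (\<Sum>c\<in>UNIV. \<Sum>d\<in>UNIV. \<Sum>a\<in>UNIV. \<Sum>b\<in>UNIV.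
      R a b c d * ip (words n) (\<lambda>zs. \<psi> (a # b # zs)) (\<lambda>zs. \<psi> (c # d # zs)))"
  proof -
    have "pair_form n R \<psi> \<psi> = (\<Sum>a\<in>UNIV. \<Sum>b\<in>UNIV. \<Sum>c\<in>UNIV. \<Sum>d\<in>UNIV. \<Sum>zs\<in>words n.
        R a b c d * (cnj (\<psi> (a # b # zs)) * \<psi> (c # d # zs)))"
      unfolding pair_form_def
      by (simp only: sum.swap[of _ UNIV "words n"] mult_ac)
    also have "\<dots> = (\<Sum>c\<in>UNIV. \<Sum>d\<in>UNIV. \<Sum>a\<in>UNIV. \<Sum>b\<in>UNIV. \<Sum>zs\<in>words n.
        R a b c d * (cnj (\<psi> (a # b # zs)) * \<psi> (c # d # zs)))"
      by (rule sum_swap_pairs)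
    finally show ?thesis
      by (simp only: ip_def sum_distrib_left)
  qed
  also have "cmod \<dots> \<le> (\<Sum>c\<in>UNIV. \<Sum>d\<in>UNIV. e * sqrt (X c d) * sqrt (F c d))"
    unfolding e_def X_def F_def
    by (intro sum_norm_le low_occupation_overlap[OF \<psi> _ low R] symmetric_fn_Cons \<psi>(1))
  also have "\<dots> = e * (\<Sum>q\<in>UNIV \<times> UNIV. sqrt (X (fst q) (snd q)) * sqrt (F (fst q) (snd q)))"
    by (simp only: sum_pairs sum_distrib_left mult.assoc)
  also have "\<dots> \<le> e * (sqrt (\<Sum>q\<in>UNIV \<times> UNIV. X (fst q) (snd q)) * sqrt (\<Sum>q\<in>UNIV \<times> UNIV. F (fst q) (snd q)))"
    by (intro mult_left_mono sum_mult_le_sqrt) (auto simp: pos e_def)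
  also have "(\<Sum>q\<in>UNIV \<times> UNIV. X (fst q) (snd q)) = nsq4 R"
    unfolding sum_pairs[of X, symmetric] unfolding X_def nsq_def nsq4_def by (rule sum_swap_pairs)
  also have "(\<Sum>q\<in>UNIV \<times> UNIV. F (fst q) (snd q)) = 1"
    unfolding sum_pairs[of F, symmetric] unfolding F_def using \<psi>(2) by (simp add: nsq_words_Suc)
  finally show ?thesis by (simp add: e_def)
qed

section \<open>Compression to the heavily occupied directions\<close>

definition quad_form ::
    "('d::finite \<Rightarrow> 'd \<Rightarrow> 'd \<Rightarrow> 'd \<Rightarrow> complex) \<Rightarrow> ('d \<Rightarrow> complex) \<Rightarrow> ('d \<Rightarrow> complex)
      \<Rightarrow> ('d \<Rightarrow> complex) \<Rightarrow> ('d \<Rightarrow> complex) \<Rightarrow> complex" where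
  "quad_form W f g h l = (\<Sum>a\<in>UNIV. \<Sum>b\<in>UNIV. \<Sum>c\<in>UNIV. \<Sum>d\<in>UNIV.
     cnj (f a) * cnj (g b) * W a b c d * (h c * l d))"

text \<open>Only the first row index is ever projected. \<open>swap_op\<close> exchanges the two row
  indices and \<open>adj_op\<close> exchanges rows with columns, so these operations reach all four
  indices.\<close>

definition proj_op where "proj_op k p W = (\<lambda>a b c d. proj k p (\<lambda>a. W a b c d) a)"
definition swap_op where "swap_op W = (\<lambda>a b c d. W b a c d)"
definition adj_op where "adj_op W = (\<lambda>a b c d. cnj (W c d a b))"

definition half_trunc where
  "half_trunc k p W = proj_op k p (swap_op (proj_op k p (swap_op W)))"

text \<open>With P the projection onto the span of \<open>p\<close>, this is W compressed to P
  tensor P; see \<open>quad_form_trunc\<close>.\<close>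

definition trunc where
  "trunc k p W = adj_op (half_trunc k p (adj_op (half_trunc k p W)))"

lemma quad_form_proj_op: "quad_form (proj_op k p W) f g h l = quad_form W (proj k p f) g h l"
proof -
  have *: "quad_form W f g h l = (\<Sum>b\<in>UNIV. \<Sum>c\<in>UNIV. \<Sum>d\<in>UNIV. cnj (g b) * (h c * l d) * ip UNIV f (\<lambda>a. W a b c d))" for W f
    unfolding quad_form_def ip_def sum_distrib_left by (subst sum_rotate) (simp only: mult_ac)
  show ?thesis
    unfolding * ip_proj_left by (simp add: proj_op_def)
qed

lemma quad_form_swap_op: "quad_form (swap_op W) f g h l = quad_form W g f h l"
  unfolding quad_form_def swap_op_def
  by (subst sum.swap) (simp only: mult.commute[of "cnj (f _)"])

lemma quad_form_adj_op: "quad_form (adj_op W) f g h l = cnj (quad_form W h l f g)"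
  unfolding quad_form_def adj_op_def cnj_sum
  by (subst sum_swap_pairs) (simp add: mult_ac)

lemma quad_form_half_trunc:
  "quad_form (half_trunc k p W) f g h l = quad_form W (proj k p f) (proj k p g) h l"
  by (simp add: half_trunc_def quad_form_proj_op quad_form_swap_op)

lemma quad_form_trunc:
  "quad_form (trunc k p W) f g h l
    = quad_form W (proj k p f) (proj k p g) (proj k p h) (proj k p l)"
  by (simp add: trunc_def quad_form_half_trunc quad_form_adj_op)

lemma nsq4_swap_op: "nsq4 (swap_op W) = nsq4 W"
  unfolding nsq4_def swap_op_def by (rule sum.swap)

lemma nsq4_adj_op: "nsq4 (adj_op W) = nsq4 W"
  unfolding nsq4_def adj_op_def by (subst sum_swap_pairs) simp

text \<open>Pythagoras for the Hilbert-Schmidt norm, so that the squared sizes of successive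
  truncation errors telescope.\<close>

lemma nsq4_diff_proj_op:
  assumes "onsys k p"
  shows "nsq4 (\<lambda>a b c d. W a b c d - proj_op k p W a b c d) = nsq4 W - nsq4 (proj_op k p W)"
proof -
  have *: "nsq4 W = (\<Sum>b\<in>UNIV. \<Sum>c\<in>UNIV. \<Sum>d\<in>UNIV. nsq UNIV (\<lambda>a. W a b c d))" for W :: "'a \<Rightarrow> 'a \<Rightarrow> 'a \<Rightarrow> 'a \<Rightarrow> complex"
    unfolding nsq4_def nsq_def by (rule sum_rotate)
  show ?thesis
    unfolding * proj_op_def nsq_minus_proj[OF assms] by (simp add: sum_subtractf)
qed

lemma pair_form_swap_op:
  assumes "symmetric_fn \<psi>"
  shows "pair_form n (swap_op W) \<psi> \<psi> = pair_form n W \<psi> \<psi>"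
  unfolding pair_form_def swap_op_def
  by (subst sum.swap[of _ UNIV UNIV]) (simp add: symmetric_fn_Cons2[OF assms])

lemma pair_form_adj_op: "pair_form n (adj_op W) \<psi> \<psi> = cnj (pair_form n W \<psi> \<psi>)"
  unfolding cnj_pair_form adj_op_def ..

lemma sum_four_le:
  fixes x y z w :: real
  shows "x + y + z + w \<le> 2 * sqrt (x\<^sup>2 + y\<^sup>2 + z\<^sup>2 + w\<^sup>2)"
proof -
  have "0 \<le> (x - y)\<^sup>2 + (x - z)\<^sup>2 + (x - w)\<^sup>2 + (y - z)\<^sup>2 + (y - w)\<^sup>2 + (z - w)\<^sup>2"
    by simp
  then have "(x + y + z + w)\<^sup>2 \<le> 4 * (x\<^sup>2 + y\<^sup>2 + z\<^sup>2 + w\<^sup>2)"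
    by (simp add: power2_eq_square algebra_simps)
  then have "x + y + z + w \<le> sqrt (4 * (x\<^sup>2 + y\<^sup>2 + z\<^sup>2 + w\<^sup>2))"
    by (rule real_le_rsqrt)
  then show ?thesis unfolding real_sqrt_mult by simp
qed

text \<open>The indices are truncated one at a time. Each discarded piece is orthogonal to
  \<open>p\<close> in its first index, so \<open>low_occupation_form\<close> applies. Since the
  squared errors telescope, \<open>sum_four_le\<close> gives a factor 2 instead of 4 for the four
  steps.\<close>

lemma pair_form_trunc_error:
  fixes \<psi> :: "'d::finite list \<Rightarrow> complex"
  assumes \<psi>: "symmetric_fn \<psi>" "nsq (words (Suc (Suc n))) \<psi> = 1" and p: "onsys k p"
    and low: "\<And>q. (\<And>i. i < k \<Longrightarrow> ip UNIV (p i) q = 0)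
        \<Longrightarrow> nsq (words (Suc n)) (annihilation q \<psi>) \<le> nsq UNIV q / real (Suc n)"
  shows "Re (pair_form n W \<psi> \<psi>) - Re (pair_form n (trunc k p W) \<psi> \<psi>)
      \<le> 4 * sqrt 2 / sqrt (real (Suc n)) * sqrt (nsq4 W)"
    and "nsq4 (trunc k p W) \<le> nsq4 W"
proof -
  define e where "e = 2 * sqrt 2 / sqrt (real (Suc n))"
  define f where "f W = Re (pair_form n W \<psi> \<psi>)" for W
  have e0: "0 \<le> e" by (simp add: e_def)
  have step: "f V - f (proj_op k p V) \<le> e * sqrt (nsq4 V - nsq4 (proj_op k p V))" for V
  proof -
    have orth: "ip UNIV (p i) (\<lambda>a. V a b c d - proj_op k p V a b c d) = 0" if "i < k" for i b c d
      unfolding proj_op_def ip_diff_right ip_onsys_proj[OF p that] by simp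
    have "cmod (pair_form n V \<psi> \<psi> - pair_form n (proj_op k p V) \<psi> \<psi>) \<le> e * sqrt (nsq4 V - nsq4 (proj_op k p V))"
      unfolding pair_form_diff[symmetric] nsq4_diff_proj_op[OF p, symmetric] e_def
      by (rule low_occupation_form[OF \<psi>, where k = k and p = p]) (rule low, blast, rule orth, assumption)
    then show ?thesis
      using complex_Re_le_cmod[of "pair_form n V \<psi> \<psi> - pair_form n (proj_op k p V) \<psi> \<psi>"]
      by (simp add: f_def)
  qed
  have mono: "nsq4 (proj_op k p V) \<le> nsq4 V" for V
    using nsq4_diff_proj_op[OF p, of V] nsq_nonneg4[of "\<lambda>a b c d. V a b c d - proj_op k p V a b c d"] by simp
  have fs: "f (swap_op V) = f V" "f (adj_op V) = f V" for V
    by (simp_all add: f_def pair_form_swap_op[OF \<psi>(1)] pair_form_adj_op)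
  \<comment> \<open>The second and then the first row index are truncated; after the adjoint the
    same is done for the columns.\<close>
  define V1 where "V1 = swap_op (proj_op k p (swap_op W))"
  define V2 where "V2 = adj_op (proj_op k p V1)"
  define V3 where "V3 = swap_op (proj_op k p (swap_op V2))"
  define V4 where "V4 = adj_op (proj_op k p V3)"
  have V4: "V4 = trunc k p W"
    by (simp add: V4_def V3_def V2_def V1_def trunc_def half_trunc_def)
  note red = fs nsq4_swap_op nsq4_adj_op
  have s: "f W - f V1 \<le> e * sqrt (nsq4 W - nsq4 V1)" "f V1 - f V2 \<le> e * sqrt (nsq4 V1 - nsq4 V2)"
      "f V2 - f V3 \<le> e * sqrt (nsq4 V2 - nsq4 V3)" "f V3 - f V4 \<le> e * sqrt (nsq4 V3 - nsq4 V4)"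
    using step[of "swap_op W"] step[of V1] step[of "swap_op V2"] step[of V3]
    by (simp_all add: V1_def V2_def V3_def V4_def red)
  have m: "nsq4 V1 \<le> nsq4 W" "nsq4 V2 \<le> nsq4 V1" "nsq4 V3 \<le> nsq4 V2" "nsq4 V4 \<le> nsq4 V3"
    using mono[of "swap_op W"] mono[of V1] mono[of "swap_op V2"] mono[of V3]
    by (simp_all add: V1_def V2_def V3_def V4_def red)
  then show "nsq4 (trunc k p W) \<le> nsq4 W"
    by (simp add: V4)
  have "f W - f V4 \<le> e * (sqrt (nsq4 W - nsq4 V1) + sqrt (nsq4 V1 - nsq4 V2)
      + sqrt (nsq4 V2 - nsq4 V3) + sqrt (nsq4 V3 - nsq4 V4))"
    using s by (simp add: distrib_left)
  also have "\<dots> \<le> e * (2 * sqrt (nsq4 W - nsq4 V4))"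
    using sum_four_le[of "sqrt (nsq4 W - nsq4 V1)" "sqrt (nsq4 V1 - nsq4 V2)"
        "sqrt (nsq4 V2 - nsq4 V3)" "sqrt (nsq4 V3 - nsq4 V4)"] m e0
    by (intro mult_left_mono) auto
  also have "\<dots> \<le> e * (2 * sqrt (nsq4 W))"
    using e0 by (intro mult_left_mono) auto
  finally show "Re (pair_form n W \<psi> \<psi>) - Re (pair_form n (trunc k p W) \<psi> \<psi>)
      \<le> 4 * sqrt 2 / sqrt (real (Suc n)) * sqrt (nsq4 W)"
    by (simp add: f_def V4 e_def)
qed

lemma hartree_eq_quad_form: "hartree W u = Re (quad_form W u u u u)"
  by (simp add: hartree_def quad_form_def)

text \<open>The Hartree energy is homogeneous of degree four, so shrinking the vector multiplies it
  by a number in [0, 1]. For negative \<open>h\<close> this can raise the energy, whence the maximum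
  with 0.\<close>

lemma hartree_le_of_subnormalised:
  fixes v :: "'d::finite \<Rightarrow> complex"
  assumes h: "\<And>u. nsq UNIV u = 1 \<Longrightarrow> hartree W u \<le> h" and v: "nsq UNIV v \<le> 1"
  shows "hartree W v \<le> max h 0"
proof (cases "nsq UNIV v = 0")
  case True
  then have "v x = 0" for x by (simp add: nsq_eq_0_iff)
  then show ?thesis by (simp add: hartree_def)
next
  case False
  define s where "s = nsq UNIV v"
  have s: "0 < s" "s \<le> 1"
    using False v nsq_nonneg[of UNIV v] unfolding s_def by linarith+
  define u where "u = (\<lambda>x. of_real (1 / sqrt s) * v x)"
  have "nsq UNIV u = 1"
    unfolding u_def nsq_scale using s by (simp add: norm_divide power_divide flip: s_def)
  then have "hartree W u \<le> h" by (rule h)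
  have vu: "v = (\<lambda>x. of_real (sqrt s) * u x)"
    using s by (simp add: u_def)
  have "quad_form W (\<lambda>x. r * u x) (\<lambda>x. r * u x) (\<lambda>x. r * u x) (\<lambda>x. r * u x)
      = cnj r * cnj r * (r * r) * quad_form W u u u u" for r
    unfolding quad_form_def by (simp add: sum_distrib_left mult_ac)
  from this[of "of_real (sqrt s)"] have "quad_form W v v v v = of_real (sqrt s * sqrt s * (sqrt s * sqrt s)) * quad_form W u u u u"
    unfolding vu by (simp only: of_real_mult complex_cnj_complex_of_real)
  then have "hartree W v = (s * s) * hartree W u"
    using s unfolding hartree_eq_quad_form by (simp del: of_real_mult)
  also have "\<dots> \<le> (s * s) * max h 0"
    using \<open>hartree W u \<le> h\<close> s by (intro mult_left_mono) auto
  also have "\<dots> \<le> 1 * max h 0"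
    using s by (intro mult_right_mono) (auto simp: mult_le_one)
  finally show ?thesis by simp
qed

lemma quad_form_hermitian:
  assumes W: "\<And>a b c d. W a b c d = cnj (W c d a b)"
  shows "quad_form W f g h l = cnj (quad_form W h l f g)"
proof -
  have "adj_op W = W"
    unfolding adj_op_def W[symmetric] ..
  then show ?thesis
    using quad_form_adj_op[of W f g h l] by simp
qed

lemma quad_form_basis:
  "quad_form W (\<lambda>x. if x = a then 1 else 0) (\<lambda>x. if x = b then 1 else 0)
     (\<lambda>x. if x = c then 1 else 0) (\<lambda>x. if x = d then 1 else 0) = W a b c d"
  unfolding quad_form_def
  by (simp add: if_distrib[of cnj] if_distrib[of "\<lambda>x. x * _"] if_distrib[of "\<lambda>x. _ * x"] cong: if_cong)

lemma trunc_hermitian: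
  fixes W :: "'d::finite \<Rightarrow> 'd \<Rightarrow> 'd \<Rightarrow> 'd \<Rightarrow> complex"
  assumes W: "\<And>a b c d. W a b c d = cnj (W c d a b)"
  shows "trunc k p W a b c d = cnj (trunc k p W c d a b)"
proof -
  define e where "e a = (\<lambda>x. if x = a then 1 else 0 :: complex)" for a :: 'd
  have basis: "quad_form V (e a) (e b) (e c) (e d) = V a b c d" for V a b c d
    unfolding e_def by (rule quad_form_basis)
  have "quad_form (trunc k p W) (e a) (e b) (e c) (e d) = cnj (quad_form (trunc k p W) (e c) (e d) (e a) (e b))"
    unfolding quad_form_trunc by (rule quad_form_hermitian[OF W])
  then show ?thesis
    by (simp only: basis)
qed

text \<open>The directions of occupation at least \<open>1 / (n + 1)\<close> number at most
  \<open>n + 1\<close>. Compressing to them costs the term with \<open>4 * sqrt 2\<close>, and the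
  low rank bound for the compression contributes \<open>sqrt (n + 1) / (n + 1)\<close>.\<close>

lemma dimension_free_mean_field_bound:
  fixes \<psi> :: "'d::finite list \<Rightarrow> complex"
  assumes W: "\<And>a b c d. W a b c d = cnj (W c d a b)"
    and h: "\<And>u. nsq UNIV u = 1 \<Longrightarrow> hartree W u \<le> h"
    and \<psi>: "symmetric_fn \<psi>" "nsq (words (Suc (Suc n))) \<psi> = 1"
  shows "Re (pair_form n W \<psi> \<psi>) \<le> max h 0 + (4 * sqrt 2 + 1) / sqrt (real (Suc n)) * sqrt (nsq4 W)"
proof -
  have one: "(\<Sum>x\<in>UNIV. nsq (words (Suc n)) (\<lambda>zs. \<psi> (x # zs))) = 1"
    using \<psi>(2) by (simp only: nsq_words_Suc[of "Suc n" \<psi>])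
  have t: "0 < 1 / real (Suc n)" by simp
  obtain k p where p: "onsys k p" and k: "real k * (1 / real (Suc n)) \<le> 1"
    and low: "\<And>q. (\<And>i. i < k \<Longrightarrow> ip UNIV (p i) q = 0)
        \<Longrightarrow> nsq (words (Suc n)) (\<lambda>zs. ip UNIV q (\<lambda>x. \<psi> (x # zs))) \<le> 1 / real (Suc n) * nsq UNIV q"
    by (rule greedy_onsys[OF t, of "words (Suc n)" "\<lambda>x zs. \<psi> (x # zs)", unfolded one])
      (erule that, assumption, blast)
  have low': "nsq (words (Suc n)) (annihilation q \<psi>) \<le> nsq UNIV q / real (Suc n)"
    if "\<And>i. i < k \<Longrightarrow> ip UNIV (p i) q = 0" for q
    using low[OF that] by (simp add: annihilation_def)
  define T where "T = trunc k p W"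
  have T1: "Re (pair_form n W \<psi> \<psi>) - Re (pair_form n T \<psi> \<psi>) \<le> 4 * sqrt 2 / sqrt (real (Suc n)) * sqrt (nsq4 W)"
    and T2: "nsq4 T \<le> nsq4 W"
    unfolding T_def by (rule pair_form_trunc_error[OF \<psi> p], rule low', blast)+
  \<comment> \<open>Taking the adjoint conjugates entries, so the column indices of \<open>T\<close>
    lie in the span of the conjugated system.\<close>
  have cp: "onsys k (\<lambda>i x. cnj (p i x))"
  proof -
    have "ip UNIV (\<lambda>x. cnj (p i x)) (\<lambda>x. cnj (p j x)) = cnj (ip UNIV (p i) (p j))" for i j
      by (simp add: ip_def)
    then show ?thesis using p by (simp add: onsys_def)
  qed
  have "Re (pair_form n T \<psi> \<psi>) \<le> (max h 0 + sqrt (nsq4 T) * sqrt (real k) / (real n + 1)) * nsq (words (n + 2)) \<psi>"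
  proof (rule mean_field_bound_low_rank[OF _ _ \<psi>(1) cp])
    show "T a b c d = cnj (T c d a b)" for a b c d
      unfolding T_def by (rule trunc_hermitian[OF W])
    show "hartree T u \<le> max h 0" if "nsq UNIV u = 1" for u
    proof -
      have "hartree T u = hartree W (proj k p u)"
        by (simp add: hartree_eq_quad_form T_def quad_form_trunc)
      moreover have "nsq UNIV (proj k p u) \<le> 1"
        using nsq_minus_proj[OF p, of u] nsq_nonneg[of UNIV "\<lambda>x. u x - proj k p u x"] that by simp
      ultimately show ?thesis
        using hartree_le_of_subnormalised[OF h] by simp
    qed
    show "proj k (\<lambda>i x. cnj (p i x)) (\<lambda>c. T a b c d) = (\<lambda>c. T a b c d)" for a b d
      unfolding T_def trunc_def adj_op_def half_trunc_def
      unfolding proj_op_def[of k p "swap_op _"] proj_cnj proj_proj[OF p] ..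
  qed
  also have "nsq (words (n + 2)) \<psi> = 1"
    using \<psi>(2) by simp
  also have "(max h 0 + sqrt (nsq4 T) * sqrt (real k) / (real n + 1)) * 1
      \<le> max h 0 + sqrt (nsq4 W) * sqrt (real (Suc n)) / real (Suc n)"
  proof -
    have "real k \<le> real (Suc n)"
      using k by (simp add: field_simps)
    then have "sqrt (nsq4 T) * sqrt (real k) \<le> sqrt (nsq4 W) * sqrt (real (Suc n))"
      using T2 by (intro mult_mono) auto
    then have "sqrt (nsq4 T) * sqrt (real k) / real (Suc n) \<le> sqrt (nsq4 W) * sqrt (real (Suc n)) / real (Suc n)"
      by (rule divide_right_mono) simp
    then show ?thesis by (simp add: add.commute)
  qed
  also have "sqrt (nsq4 W) * sqrt (real (Suc n)) / real (Suc n) = sqrt (nsq4 W) / sqrt (real (Suc n))"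
    by (simp add: real_div_sqrt field_simps)
  finally show ?thesis
    using T1 by (simp add: add_divide_distrib distrib_right)
qed

subsection \<open>Density operators and the closest separable state\<close>

definition sesq :: "'i set \<Rightarrow> ('i \<Rightarrow> 'i \<Rightarrow> complex) \<Rightarrow> ('i \<Rightarrow> complex) \<Rightarrow> ('i \<Rightarrow> complex) \<Rightarrow> complex" where
  "sesq T A f g = (\<Sum>x\<in>T. \<Sum>y\<in>T. cnj (f x) * A x y * g y)"

lemma sesq_add:
  "sesq T A (\<lambda>x. f x + g x) (\<lambda>x. f x + g x) = sesq T A f f + sesq T A f g + sesq T A g f + sesq T A g g"
  by (simp add: sesq_def algebra_simps sum.distrib)

lemma sesq_shift:
  assumes "finite T" "z \<in> T" and A: "\<And>x y. A y x = cnj (A x y)"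
  shows "Re (sesq T A (\<lambda>x. f x + (if x = z then c else 0)) (\<lambda>x. f x + (if x = z then c else 0)))
    = Re (sesq T A f f) + 2 * Re (c * (\<Sum>x\<in>T. cnj (f x) * A x z)) + (cmod c)\<^sup>2 * Re (A z z)"
proof -
  define e where "e x = (if x = z then c else 0)" for x
  define s where "s = (\<Sum>x\<in>T. cnj (f x) * A x z)"
  have fe: "sesq T A f e = c * s"
    unfolding sesq_def e_def s_def using assms(1,2)
    by (simp add: if_distrib[of "\<lambda>x. _ * x"] sum_distrib_left mult_ac cong: if_cong)
  have "sesq T A e f = cnj (sesq T A f e)"
    unfolding sesq_def cnj_sum
    by (subst sum.swap) (simp add: A[symmetric] mult_ac)
  moreover have "sesq T A e e = c * cnj c * A z z"
    unfolding sesq_def e_def using assms(1,2)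
    by (simp add: if_distrib[of cnj] if_distrib[of "\<lambda>x. _ * x"] if_distrib[of "\<lambda>x. x * _"] if_distrib[of "sum _"] cong: if_cong)
  then have "sesq T A e e = of_real ((cmod c)\<^sup>2) * A z z"
    by (simp only: complex_norm_square)
  ultimately show ?thesis
    unfolding e_def[symmetric] sesq_add s_def[symmetric] fe by simp
qed

text \<open>Cholesky elimination: each step splits off a pivot column and leaves a positive Schur
  complement on one index fewer. All vectors are combinations of columns of \<open>A\<close>, so a
  linear property \<open>P\<close> of the columns is inherited. Later \<open>P\<close> is
  symmetry.\<close>

lemma psd_decomposition:
  fixes A :: "'i \<Rightarrow> 'i \<Rightarrow> complex"
  assumes "finite T" and "\<And>x y. A y x = cnj (A x y)"
    and "\<And>x y. x \<notin> T \<Longrightarrow> A x y = 0"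
    and "\<And>f. 0 \<le> Re (sesq T A f f)"
    and "\<And>y. P (\<lambda>x. A x y)"
    and P: "\<And>f g a b. P f \<Longrightarrow> P g \<Longrightarrow> P (\<lambda>x. a * f x + b * g x)"
  obtains m :: nat and v where "\<And>i. P (v i)" "\<And>x y. A x y = (\<Sum>i<m. v i x * cnj (v i y))"
proof -
  have "\<exists>m v. (\<forall>i. P (v i)) \<and> (\<forall>x y. A x y = (\<Sum>i<(m::nat). v i x * cnj (v i y)))"
    using assms(1-5)
  proof (induction T arbitrary: A rule: finite_induct)
    case empty
    then have "A x y = 0" for x y by simp
    then show ?case
      using empty(4) by (intro exI[of _ 0] exI[of _ "\<lambda>_ x. A x y" for y]) auto
  next
    case (insert z T)
    define a where "a = Re (A z z)"
    have Azz: "A z z = of_real a"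
      using insert.prems(1)[of z z] by (simp add: a_def complex_eq_iff)
    have fin: "finite (insert z T)" "z \<in> insert z T" using insert.hyps by auto
    note shift = sesq_shift[OF fin insert.prems(1)]
    have a0: "0 \<le> a"
      using insert.prems(3)[of "\<lambda>x. 0 + (if x = z then 1 else 0)"] shift[where f = "\<lambda>_. 0" and c = 1]
      by (simp add: sesq_def a_def)
    \<comment> \<open>The Schur complement at the pivot \<open>z\<close>. For \<open>a = 0\<close>
      the quotient is 0 by convention, which is right because \<open>row\<close> shows the pivot
      column to vanish.\<close>
    define B where "B x y = A x y - A x z * cnj (A y z) / of_real a" for x y
    have row: "A x z = 0" if "a = 0" for x
    proof -
      define f where "f x = A x z" for x
      have "(\<Sum>x\<in>insert z T. cnj (f x) * A x z) = of_real (nsq (insert z T) f)"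
        unfolding ip_self[symmetric] ip_def f_def ..
      then have "0 \<le> Re (sesq (insert z T) A f f) + 2 * (t * nsq (insert z T) f)" for t
        using insert.prems(3)[of "\<lambda>x. f x + (if x = z then of_real t else 0)"] shift[where f = f and c = "of_real t"] that
        by (simp add: a_def)
      \<comment> \<open>For a nonzero column this choice of \<open>t\<close> would make the form
        negative.\<close>
      from this[of "- (Re (sesq (insert z T) A f f) + 1) / nsq (insert z T) f"]
      have "nsq (insert z T) f = 0"
        using insert.prems(3)[of f] by (cases "nsq (insert z T) f = 0") auto
      then have "\<forall>x\<in>insert z T. f x = 0"
        using fin by (simp add: nsq_eq_0_iff)
      then show ?thesis
        using insert.prems(2)[of x z] by (auto simp: f_def)
    qed
    have Bh: "B y x = cnj (B x y)" for x y
      using insert.prems(1)[of x y] by (simp add: B_def mult.commute)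
    have "\<exists>m v. (\<forall>i. P (v i)) \<and> (\<forall>x y. B x y = (\<Sum>i<(m::nat). v i x * cnj (v i y)))"
    proof (rule insert.IH)
      show "B y x = cnj (B x y)" for x y
        by (rule Bh)
      have Bz: "B z y = 0" for y
      proof (cases "a = 0")
        case True
        then show ?thesis
          using row[OF True, of y] insert.prems(1)[of y z] by (simp add: B_def)
      next
        case False
        then show ?thesis
          using insert.prems(1)[of y z] by (simp add: B_def Azz)
      qed
      show "B x y = 0" if "x \<notin> T" for x y
      proof (cases "x = z")
        case False
        with that insert.prems(2)[of x] show ?thesis by (simp add: B_def)
      qed (simp add: Bz)
      have Bz': "B y z = 0" for y
        using Bz[of y] Bh[where x = z and y = y] by simp
      show "0 \<le> Re (sesq T B f f)" for f
      proof -
        define s where "s = (\<Sum>x\<in>insert z T. cnj (f x) * A x z)"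
        \<comment> \<open>Completing the square: for a positive pivot, shifting coordinate
          \<open>z\<close> of \<open>f\<close> by \<open>c\<close> minimises the form of
          \<open>A\<close>, and the minimum is the form of \<open>B\<close>.\<close>
        define c where "c = - cnj s / of_real a"
        have "sesq T B f f = sesq (insert z T) B f f"
          unfolding sesq_def using insert.hyps Bz Bz' by simp
        also have "\<dots> = sesq (insert z T) A f f - s * cnj s / of_real a"
          unfolding s_def cnj_sum sum_product sesq_def B_def
          by (simp add: right_diff_distrib left_diff_distrib sum_subtractf sum_divide_distrib mult_ac del: sum.insert)
        finally have "Re (sesq T B f f) = Re (sesq (insert z T) A f f) - (cmod s)\<^sup>2 / a"
          by (simp add: complex_norm_square[symmetric] del: of_real_power flip: of_real_divide)
        also have "\<dots> = Re (sesq (insert z T) A (\<lambda>x. f x + (if x = z then c else 0)) (\<lambda>x. f x + (if x = z then c else 0)))"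
        proof (cases "a = 0")
          case True
          then show ?thesis
            unfolding shift by (simp add: c_def)
        next
          case False
          have "Re (c * s) = - (cmod s)\<^sup>2 / a"
            unfolding c_def by (simp add: mult.commute[of "cnj s"] complex_norm_square[symmetric] del: of_real_power flip: of_real_divide of_real_minus)
          moreover have "(cmod c)\<^sup>2 * a = (cmod s)\<^sup>2 / a"
            using False by (simp add: c_def norm_divide power_divide power2_eq_square)
          ultimately show ?thesis
            unfolding shift s_def[symmetric] a_def[symmetric] by simp
        qed
        also have "\<dots> \<ge> 0" by (rule insert.prems(3))
        finally show ?thesis .
      qed
      show "P (\<lambda>x. B x y)" for y
        using P[OF insert.prems(4)[of y] insert.prems(4)[of z], of 1 "- (cnj (A y z) / of_real a)"]
        by (simp add: B_def mult_ac)
    qed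
    then obtain m v where v: "\<And>i. P (v i)" "\<And>x y. B x y = (\<Sum>i<(m::nat). v i x * cnj (v i y))"
      by blast
    define w where "w x = A x z / of_real (sqrt a)" for x
    have "A x y = B x y + w x * cnj (w y)" for x y
    proof -
      have "complex_of_real (sqrt a) * of_real (sqrt a) = of_real a"
        using a0 by (simp flip: of_real_mult)
      then show ?thesis by (simp add: B_def w_def)
    qed
    moreover have "P w"
      using P[OF insert.prems(4)[of z] insert.prems(4)[of z], of "1 / of_real (sqrt a)" 0]
      by (simp add: w_def[abs_def])
    ultimately show ?case
      using v by (intro exI[of _ "Suc m"] exI[of _ "v(m := w)"]) auto
  qed
  then show thesis using that by blast
qed

text \<open>The columns of \<open>\<rho>\<close> are images of basis vectors, hence symmetric, and
  \<open>psd_decomposition\<close> applies with symmetry as the inherited property. The weights of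
  the mixture sit in the norms of the \<open>v i\<close>, which add up to the trace.\<close>

lemma sym_density_decomposition:
  fixes \<rho> :: "'d::finite list \<Rightarrow> 'd list \<Rightarrow> complex"
  assumes "\<rho> \<in> sym_density_ops N"
  obtains m :: nat and v where "\<And>i. symmetric_fn (v i)" "\<And>x y. \<rho> x y = (\<Sum>i<m. v i x * cnj (v i y))"
    "(\<Sum>i<m. nsq (words N) (v i)) = 1"
proof -
  have ops: "\<rho> \<in> tensor_ops N" and herm: "\<And>x y. \<rho> y x = cnj (\<rho> x y)"
    and psd: "\<And>\<psi>. \<psi> \<in> tensor_space N \<Longrightarrow> 0 \<le> Re (tensor_inner N \<psi> (tensor_apply N \<rho> \<psi>))"
    and tr: "tensor_trace N \<rho> = 1"
    and sym: "\<And>\<psi>. \<psi> \<in> tensor_space N \<Longrightarrow> tensor_apply N \<rho> \<psi> \<in> sym_space N"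
    using assms unfolding sym_density_ops_def density_ops_def by blast+
  have zero: "\<rho> x y = 0" if "x \<notin> words N \<or> y \<notin> words N" for x y
    using ops that by (auto simp: tensor_ops_def)
  have pos: "0 \<le> Re (sesq (words N) \<rho> f f)" for f
  proof -
    define g where "g x = (if length x = N then f x else 0)" for x
    have "g \<in> tensor_space N" by (simp add: g_def tensor_space_def)
    moreover have "tensor_inner N g (tensor_apply N \<rho> g) = sesq (words N) \<rho> f f"
      unfolding tensor_inner_def tensor_apply_def sesq_def sum_distrib_left
      by (intro sum.cong refl) (simp add: g_def)
    ultimately show ?thesis using psd[of g] by simp
  qed
  have col: "symmetric_fn (\<lambda>x. \<rho> x y)" for y
  proof (cases "length y = N")
    case True
    define e where "e x = (if x = y then 1 else 0 :: complex)" for x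
    have "e \<in> tensor_space N" using True by (auto simp: e_def tensor_space_def)
    from sym[OF this] have "symmetric_fn (tensor_apply N \<rho> e)"
      by (simp add: sym_space_eq)
    moreover have "tensor_apply N \<rho> e = (\<lambda>x. \<rho> x y)"
      using True by (simp add: tensor_apply_def e_def if_distrib[of "\<lambda>a. _ * a"] cong: if_cong)
    ultimately show ?thesis by simp
  next
    case False
    then have "(\<lambda>x. \<rho> x y) = (\<lambda>_. 0)" using zero by auto
    then show ?thesis by (simp add: symmetric_fn_def)
  qed
  have lin: "symmetric_fn (\<lambda>x. a * f x + b * g x)" if "symmetric_fn f" "symmetric_fn g"
    for f g :: "'d list \<Rightarrow> complex" and a b
    using that unfolding symmetric_fn_def by metis
  obtain m :: nat and v where v: "\<And>i. symmetric_fn (v i)" "\<And>x y. \<rho> x y = (\<Sum>i<m. v i x * cnj (v i y))"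
    by (rule psd_decomposition[of "words N" \<rho> symmetric_fn, OF _ herm _ pos col lin])
      (use zero in auto)
  have "of_real (\<Sum>i<m. nsq (words N) (v i)) = tensor_trace N \<rho>"
    unfolding tensor_trace_def v(2) of_real_sum nsq_def complex_norm_square
    by (subst sum.swap) simp
  then have "(\<Sum>i<m. nsq (words N) (v i)) = 1"
    unfolding tr by (metis of_real_eq_1_iff)
  then show thesis by (rule that[OF v])
qed

section \<open>Two-body matrices, separable states and marginals\<close>

definition entries :: "complex ^ ('d \<times> 'd) ^ ('d \<times> 'd) \<Rightarrow> 'd::finite \<Rightarrow> 'd \<Rightarrow> 'd \<Rightarrow> 'd \<Rightarrow> complex" where
  "entries A a b c d = A $ (a, b) $ (c, d)"

lemma inner_eq_sum_entries:
  "inner A B = Re (\<Sum>a\<in>UNIV. \<Sum>b\<in>UNIV. \<Sum>c\<in>UNIV. \<Sum>d\<in>UNIV. entries A a b c d * cnj (entries B a b c d))"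
  for A B :: "complex ^ ('d::finite \<times> 'd) ^ ('d \<times> 'd)"
proof -
  have "inner A B = Re (\<Sum>i\<in>UNIV \<times> UNIV. \<Sum>j\<in>UNIV \<times> UNIV. A $ i $ j * cnj (B $ i $ j))"
    by (simp add: inner_vec_def inner_complex_def)
  then show ?thesis
    by (simp only: entries_def sum_Times)
qed

lemma norm_power2_eq_nsq4: "(norm A)\<^sup>2 = nsq4 (entries A)"
  for A :: "complex ^ ('d::finite \<times> 'd) ^ ('d \<times> 'd)"
proof -
  have "z * cnj z = of_real ((cmod z)\<^sup>2)" for z
    by (rule complex_norm_square[symmetric])
  then show ?thesis
    by (simp add: power2_norm_eq_inner inner_eq_sum_entries nsq4_def del: of_real_power)
qed

lemma inner_product_state:
  "inner A (kronecker (ket_bra u) (ket_bra u)) = hartree (entries A) (\<lambda>x. u $ x)"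
  for A :: "complex ^ ('d::finite \<times> 'd) ^ ('d \<times> 'd)"
  unfolding inner_eq_sum_entries hartree_def
  by (simp add: entries_def kronecker_def ket_bra_def mult_ac)

lemma norm_eq_1_iff_nsq: "norm u = 1 \<longleftrightarrow> nsq UNIV (\<lambda>x. u $ x) = 1"
  for u :: "complex ^ 'd::finite"
  by (simp add: norm_vec_def L2_set_def nsq_def)

lemma compact_SEP2: "compact (SEP2 :: (complex ^ ('d::finite \<times> 'd) ^ ('d \<times> 'd)) set)"
proof -
  have "{kronecker (ket_bra u) (ket_bra u) | u :: complex ^ 'd. norm u = 1}
      = (\<lambda>u. kronecker (ket_bra u) (ket_bra u)) ` sphere 0 1"
    by auto
  moreover have "continuous_on (sphere 0 1) (\<lambda>u :: complex ^ 'd. kronecker (ket_bra u) (ket_bra u))"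
    unfolding kronecker_def ket_bra_def
    by (auto intro!: continuous_on_vec_lambda continuous_intros continuous_on_component)
  ultimately show ?thesis
    unfolding SEP2_def by (simp add: compact_convex_hull compact_continuous_image)
qed

lemma SEP2_nonempty: "(SEP2 :: (complex ^ ('d::finite \<times> 'd) ^ ('d \<times> 'd)) set) \<noteq> {}"
proof -
  obtain u :: "complex ^ 'd" where "norm u = 1"
    using vector_choose_size[of 1] by auto
  then show ?thesis
    unfolding SEP2_def by auto
qed

text \<open>Hermitian matrices form a convex set that contains the product states, hence their
  convex hull.\<close>

lemma entries_SEP2_hermitian:
  assumes "\<tau> \<in> SEP2"
  shows "entries \<tau> a b c d = cnj (entries \<tau> c d a b)"
proof -
  define H where "H = {A :: complex ^ ('a \<times> 'a) ^ ('a \<times> 'a). \<forall>i j. A $ i $ j = cnj (A $ j $ i)}"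
  have "convex H"
    unfolding convex_def H_def
  proof (intro ballI allI impI CollectI)
    fix A B :: "complex ^ ('a \<times> 'a) ^ ('a \<times> 'a)" and s t :: real and i j
    assume "A \<in> {A. \<forall>i j. A $ i $ j = cnj (A $ j $ i)}" "B \<in> {A. \<forall>i j. A $ i $ j = cnj (A $ j $ i)}"
    then have "A $ i $ j = cnj (A $ j $ i)" "B $ i $ j = cnj (B $ j $ i)" by blast+
    then show "(s *\<^sub>R A + t *\<^sub>R B) $ i $ j = cnj ((s *\<^sub>R A + t *\<^sub>R B) $ j $ i)"
      by (simp add: complex_cnj_scaleR)
  qed
  moreover have "kronecker (ket_bra u) (ket_bra u) \<in> H" for u
    by (simp add: H_def kronecker_def ket_bra_def mult_ac)
  then have "{kronecker (ket_bra u) (ket_bra u) | u. norm u = 1} \<subseteq> H"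
    by blast
  ultimately have "SEP2 \<subseteq> H"
    unfolding SEP2_def by (intro hull_minimal)
  with assms have "\<tau> \<in> H" by blast
  then show ?thesis
    unfolding H_def entries_def by blast
qed

lemma entries_marginal2:
  assumes "\<And>x y. \<rho> x y = (\<Sum>i<m. v i x * cnj (v i y))"
  shows "entries (marginal2 N \<rho>) a b c d
    = (\<Sum>i<m. \<Sum>zs\<in>words (N - 2). v i (a # b # zs) * cnj (v i (c # d # zs)))"
  unfolding entries_def marginal2_def assms by (simp add: sum.swap[of _ "{..<m}"])

text \<open>Duality of the partial trace: testing the marginal with \<open>A\<close> gives the
  energy of \<open>A\<close> acting on the first two factors of the full state.\<close>

lemma inner_marginal2:
  fixes A :: "complex ^ ('d::finite \<times> 'd) ^ ('d \<times> 'd)"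
  assumes "\<And>x y. \<rho> x y = (\<Sum>i<m. v i x * cnj (v i y))"
  shows "inner A (marginal2 N \<rho>) = (\<Sum>i<m. Re (pair_form (N - 2) (entries A) (v i) (v i)))"
proof -
  have "(\<Sum>i<m. pair_form (N - 2) (entries A) (v i) (v i))
      = (\<Sum>a\<in>UNIV. \<Sum>b\<in>UNIV. \<Sum>c\<in>UNIV. \<Sum>d\<in>UNIV. \<Sum>i<m. \<Sum>zs\<in>words (N - 2).
          cnj (v i (a # b # zs)) * entries A a b c d * v i (c # d # zs))"
    unfolding pair_form_def by (simp only: sum.swap[of _ UNIV "words (N - 2)"] sum.swap[of _ UNIV "{..<m}"])
  also have "\<dots> = (\<Sum>a\<in>UNIV. \<Sum>b\<in>UNIV. \<Sum>c\<in>UNIV. \<Sum>d\<in>UNIV.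
      entries A a b c d * cnj (entries (marginal2 N \<rho>) a b c d))"
    unfolding entries_marginal2[OF assms] by (simp add: sum_distrib_left mult_ac)
  finally show ?thesis
    unfolding inner_eq_sum_entries Re_sum[symmetric] by (simp only:)
qed

lemma entries_marginal2_hermitian:
  assumes "\<And>x y. \<rho> x y = (\<Sum>i<m. v i x * cnj (v i y))"
  shows "entries (marginal2 N \<rho>) a b c d = cnj (entries (marginal2 N \<rho>) c d a b)"
  unfolding entries_marginal2[OF assms] by (simp add: mult.commute)

text \<open>Averaging the Hartree energies of the standard basis vectors bounds \<open>h\<close>
  below by the mean of the entries \<open>W x x x x\<close>, which Cauchy-Schwarz controls. In large
  dimension \<open>h\<close> is therefore almost nonnegative, and the positive part in
  \<open>dimension_free_mean_field_bound\<close> becomes affordable.\<close>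

lemma hartree_average_bound:
  fixes W :: "'d::finite \<Rightarrow> 'd \<Rightarrow> 'd \<Rightarrow> 'd \<Rightarrow> complex"
  assumes h: "\<And>u. nsq UNIV u = 1 \<Longrightarrow> hartree W u \<le> h"
  shows "- sqrt (nsq4 W) / sqrt (real CARD('d)) \<le> h"
proof -
  define D where "D = real CARD('d)"
  have "0 < D" by (simp add: D_def)
  have diag: "Re (W x x x x) \<le> h" for x
  proof -
    define e where "e y = (if y = x then 1 else 0 :: complex)" for y
    have "nsq UNIV e = 1"
      by (simp add: nsq_def e_def if_distrib[of cmod] if_distrib[of "\<lambda>a. a\<^sup>2"] cong: if_cong)
    moreover have "quad_form W e e e e = W x x x x"
      unfolding e_def by (rule quad_form_basis)
    ultimately show ?thesis
      using h[of e] by (simp add: hartree_eq_quad_form)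
  qed
  have "cmod (\<Sum>x\<in>UNIV. W x x x x) \<le> sqrt D * sqrt (\<Sum>x\<in>UNIV. (cmod (W x x x x))\<^sup>2)"
    using cauchy_schwarz[of UNIV "\<lambda>_. 1" "\<lambda>x. W x x x x"] by (simp add: ip_def nsq_def D_def)
  also have "\<dots> \<le> sqrt D * sqrt (nsq4 W)"
  proof (intro mult_left_mono real_sqrt_le_mono)
    show "(\<Sum>x\<in>UNIV. (cmod (W x x x x))\<^sup>2) \<le> nsq4 W"
      unfolding nsq4_def
    proof (rule sum_mono)
      fix x :: 'd
      have "(cmod (W x x x x))\<^sup>2 \<le> (\<Sum>d\<in>UNIV. (cmod (W x x x d))\<^sup>2)"
        by (rule member_le_sum) auto
      also have "\<dots> \<le> (\<Sum>c\<in>UNIV. \<Sum>d\<in>UNIV. (cmod (W x x c d))\<^sup>2)"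
        by (rule member_le_sum[of x UNIV "\<lambda>c. \<Sum>d\<in>UNIV. (cmod (W x x c d))\<^sup>2"]) (auto intro: sum_nonneg)
      also have "\<dots> \<le> (\<Sum>b\<in>UNIV. \<Sum>c\<in>UNIV. \<Sum>d\<in>UNIV. (cmod (W x b c d))\<^sup>2)"
        by (rule member_le_sum[of x UNIV "\<lambda>b. \<Sum>c\<in>UNIV. \<Sum>d\<in>UNIV. (cmod (W x b c d))\<^sup>2"]) (auto intro!: sum_nonneg)
      finally show "(cmod (W x x x x))\<^sup>2 \<le> (\<Sum>b\<in>UNIV. \<Sum>c\<in>UNIV. \<Sum>d\<in>UNIV. (cmod (W x b c d))\<^sup>2)" .
    qed
  qed (auto simp: D_def)
  finally have "- (sqrt D * sqrt (nsq4 W)) \<le> Re (\<Sum>x\<in>UNIV. W x x x x)"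
    using abs_Re_le_cmod[of "\<Sum>x\<in>UNIV. W x x x x"] by linarith
  also have "\<dots> \<le> (\<Sum>x\<in>(UNIV :: 'd set). h)"
    unfolding Re_sum by (rule sum_mono) (rule diag)
  also have "\<dots> = sqrt D * (sqrt D * h)"
    using \<open>0 < D\<close> by (simp add: D_def mult.assoc[symmetric])
  finally have "sqrt D * (- sqrt (nsq4 W)) \<le> sqrt D * (sqrt D * h)"
    by simp
  then have "- sqrt (nsq4 W) \<le> sqrt D * h"
    by (rule mult_left_le_imp_le) (simp add: \<open>0 < D\<close>)
  then have "- sqrt (nsq4 W) / sqrt D \<le> h"
    using \<open>0 < D\<close> by (simp only: pos_divide_le_eq real_sqrt_gt_zero mult.commute)
  then show ?thesis
    by (simp only: D_def)
qed

text \<open>When the first term of the minimum is smaller, \<open>mean_field_bound\<close> suffices.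
  Otherwise the dimension is large compared with \<open>n\<close>, which allows
  \<open>max h 0\<close> to be replaced by \<open>h\<close> in the dimension-free bound.\<close>

lemma two_body_hartree_gap:
  fixes W :: "'d::finite \<Rightarrow> 'd \<Rightarrow> 'd \<Rightarrow> 'd \<Rightarrow> complex"
  assumes W: "\<And>a b c d. W a b c d = cnj (W c d a b)"
    and h: "\<And>u. nsq UNIV u = 1 \<Longrightarrow> hartree W u \<le> h"
    and \<psi>: "symmetric_fn \<psi>"
  shows "Re (pair_form n W \<psi> \<psi>)
    \<le> (h + min (sqrt (real CARD('d) - 1) / real (Suc n)) (8 / sqrt (real (Suc n))) * sqrt (nsq4 W))
      * nsq (words (n + 2)) \<psi>"
proof (cases "sqrt (real CARD('d) - 1) / real (Suc n) \<le> 8 / sqrt (real (Suc n))")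
  case True
  then show ?thesis
    using mean_field_bound[OF W h \<psi>, of n] by (simp add: min_absorb1 mult_ac add_ac)
next
  case False
  define K where "K = sqrt (real (Suc n))"
  define D where "D = real CARD('d)"
  have K: "0 < K" "K * K = real (Suc n)" by (simp_all add: K_def)
  have "8 / K < sqrt (D - 1) / (K * K)"
    using False by (simp add: K D_def K_def)
  then have "8 / K * (K * K) < sqrt (D - 1)"
    by (rule pos_less_divide_eq[THEN iffD1, rotated]) (use K in simp)
  then have "8 * K < sqrt (D - 1)"
    using K(1) by simp
  also have "\<dots> \<le> sqrt D" by simp
  \<comment> \<open>Failure of the case condition means that the dimension exceeds
    \<open>64 * (n + 1)\<close>.\<close>
  finally have K8: "8 * K < sqrt D" .
  with K(1) have "0 < sqrt D" by linarith
  with K8 K(1) have KD: "1 / sqrt D \<le> 1 / (8 * K)"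
    by (intro divide_left_mono mult_pos_pos) linarith+
  define Q where "Q = sqrt (nsq4 W)"
  have Q: "0 \<le> Q" by (simp add: Q_def)
  have "max h 0 \<le> h + Q / (8 * K)"
  proof -
    have "- h \<le> Q * (1 / sqrt D)"
      using hartree_average_bound[OF h] by (simp add: Q_def D_def)
    also have "\<dots> \<le> Q * (1 / (8 * K))"
      using KD Q by (rule mult_left_mono)
    finally show ?thesis using Q K by (simp add: max_def)
  qed
  \<comment> \<open>Origin of the constant 8: it absorbs \<open>4 * sqrt 2 + 1\<close> from the
    dimension-free bound and \<open>1 / 8\<close> from the positive part of
    \<open>h\<close>.\<close>
  moreover have "(4 * sqrt 2 + 1) / K * Q + Q / (8 * K) \<le> 8 / K * Q"
  proof -
    have "sqrt 2 \<le> 3 / 2"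
      by (rule real_le_lsqrt) (auto simp: power2_eq_square)
    then have "(4 * sqrt 2 + 1 + 1 / 8) * (Q / K) \<le> 8 * (Q / K)"
      using Q K by (intro mult_right_mono) auto
    then show ?thesis by (simp add: algebra_simps add_divide_distrib)
  qed
  ultimately have up: "max h 0 + (4 * sqrt 2 + 1) / K * Q \<le> h + 8 / K * Q"
    by linarith
  have min8: "min (sqrt (real CARD('d) - 1) / real (Suc n)) (8 / sqrt (real (Suc n))) = 8 / K"
    using False by (simp add: K_def)
  show ?thesis
  proof (cases "nsq (words (n + 2)) \<psi> = 0")
    case True
    then have "pair_form n W \<psi> \<psi> = pair_form n W (\<lambda>xs. 0) (\<lambda>xs. 0)"
      by (intro pair_form_cong) (auto simp: nsq_eq_0_iff)
    then show ?thesis using True by (simp add: pair_form_def)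
  next
    case False
    define s where "s = nsq (words (n + 2)) \<psi>"
    have s: "0 < s" using False nsq_nonneg[of "words (n + 2)" \<psi>] unfolding s_def by linarith
    \<comment> \<open>The dimension-free bound is stated for unit tensors, so \<open>\<psi>\<close>
      is rescaled.\<close>
    define \<phi> where "\<phi> = (\<lambda>xs. of_real (1 / sqrt s) * \<psi> xs)"
    have r: "(cmod (of_real (1 / sqrt s)))\<^sup>2 = 1 / s"
      using s by (simp add: norm_divide power_divide)
    have "nsq (words (Suc (Suc n))) \<phi> = 1"
      unfolding \<phi>_def nsq_scale r using s by (simp add: s_def)
    moreover have "symmetric_fn \<phi>"
      using \<psi> unfolding \<phi>_def symmetric_fn_def by metis
    ultimately have "Re (pair_form n W \<phi> \<phi>) \<le> max h 0 + (4 * sqrt 2 + 1) / K * Q"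
      using dimension_free_mean_field_bound[OF W h, of \<phi> n] by (simp add: K_def Q_def)
    also note up
    also have "pair_form n W \<phi> \<phi> = of_real (1 / sqrt s * (1 / sqrt s)) * pair_form n W \<psi> \<psi>"
      unfolding \<phi>_def pair_form_scale_left pair_form_scale_right by (simp only: complex_cnj_complex_of_real of_real_mult mult.assoc)
    also have "1 / sqrt s * (1 / sqrt s) = 1 / s"
      using s by (simp flip: power2_eq_square add: power_divide)
    finally have "Re (pair_form n W \<psi> \<psi>) \<le> (h + 8 / K * Q) * s"
      using s by (simp add: divide_le_eq)
    then show ?thesis
      unfolding min8 s_def Q_def .
  qed
qed

theorem theorem6p1:
  fixes N :: nat
  assumes "N \<ge> 2" and "CARD('d::finite) \<ge> 2"
  shows "(SUP \<rho> \<in> (BOS2 N :: (complex ^ ('d \<times> 'd) ^ ('d \<times> 'd)) set).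
            INF \<tau> \<in> SEP2. ereal (hs_norm (\<rho> - \<tau>)))
         \<le> ereal (min (sqrt (real CARD('d) - 1) / (real N - 1)) (8 / sqrt (real N - 1)))"
proof (rule SUP_least)
  fix \<sigma> :: "complex ^ ('d \<times> 'd) ^ ('d \<times> 'd)"
  assume "\<sigma> \<in> BOS2 N"
  then obtain \<rho> where \<rho>: "\<rho> \<in> sym_density_ops N" and \<sigma>: "\<sigma> = marginal2 N \<rho>"
    by (auto simp: BOS2_def)
  obtain m :: nat and v where sym: "\<And>i. symmetric_fn (v i)"
    and dec: "\<And>x y. \<rho> x y = (\<Sum>i<m. v i x * cnj (v i y))" and tr: "(\<Sum>i<m. nsq (words N) (v i)) = 1"
    by (rule sym_density_decomposition[OF \<rho>]) (rule that)
  define B where "B = min (sqrt (real CARD('d) - 1) / (real N - 1)) (8 / sqrt (real N - 1))"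
  have B0: "0 \<le> B" using assms by (simp add: B_def)
  define \<tau> :: "complex ^ ('d \<times> 'd) ^ ('d \<times> 'd)" where "\<tau> = closest_point SEP2 \<sigma>"
  have closed: "closed (SEP2 :: (complex ^ ('d \<times> 'd) ^ ('d \<times> 'd)) set)"
    by (rule compact_imp_closed[OF compact_SEP2])
  have convex: "convex (SEP2 :: (complex ^ ('d \<times> 'd) ^ ('d \<times> 'd)) set)"
    unfolding SEP2_def by (rule convex_convex_hull)
  have \<tau>: "\<tau> \<in> SEP2"
    unfolding \<tau>_def by (rule closest_point_in_set[OF closed SEP2_nonempty])
  define A where "A = \<sigma> - \<tau>"
  define h where "h = inner A \<tau>"
  define W where "W = entries A"
  have herm: "W a b c d = cnj (W c d a b)" for a b c d
    using entries_marginal2_hermitian[OF dec, where N = N and a = a and b = b and c = c and d = d] entries_SEP2_hermitian[OF \<tau>, where a = a and b = b and c = c and d = d]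
    by (simp add: W_def A_def \<sigma> entries_def)
  \<comment> \<open>The variational inequality at the closest point says that \<open>\<tau>\<close>
    maximises the inner product with \<open>A\<close> over \<open>SEP2\<close>, in particular
    against the product states.\<close>
  have hart: "hartree W u \<le> h" if "nsq UNIV u = 1" for u
  proof -
    define w :: "complex ^ 'd" where "w = (\<chi> x. u x)"
    have "norm w = 1"
      using that by (simp add: norm_eq_1_iff_nsq w_def)
    then have "kronecker (ket_bra w) (ket_bra w) \<in> SEP2"
      unfolding SEP2_def by (intro hull_inc) blast
    then have "inner A (kronecker (ket_bra w) (ket_bra w) - \<tau>) \<le> 0"
      unfolding A_def \<tau>_def by (rule closest_point_dot[OF convex closed])
    then show ?thesis
      by (simp add: inner_diff_right inner_product_state w_def W_def h_def)
  qed
  \<comment> \<open>The marginal keeps two factors and traces out \<open>n\<close>, so the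
    denominators \<open>real (Suc n)\<close> are \<open>real N - 1\<close>.\<close>
  define n where "n = N - 2"
  have N: "N = n + 2" using assms by (simp add: n_def)
  have B_n: "B = min (sqrt (real CARD('d) - 1) / real (Suc n)) (8 / sqrt (real (Suc n)))"
    by (simp add: B_def N)
  have "inner A \<sigma> = (\<Sum>i<m. Re (pair_form n W (v i) (v i)))"
    unfolding \<sigma> W_def n_def by (rule inner_marginal2[OF dec])
  also have "\<dots> \<le> (\<Sum>i<m. (h + B * sqrt (nsq4 W)) * nsq (words N) (v i))"
    unfolding B_n N by (intro sum_mono two_body_hartree_gap[OF herm hart sym])
  also have "\<dots> = h + B * norm A"
    unfolding sum_distrib_left[symmetric] tr W_def norm_power2_eq_nsq4[symmetric] by simp
  finally have "inner A \<sigma> - h \<le> B * norm A"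
    by simp
  \<comment> \<open>The squared distance is the excess of the energy of \<open>\<sigma>\<close> over
    \<open>h\<close>; dividing by \<open>norm A\<close> then gives the bound.\<close>
  moreover have "norm A * norm A = inner A \<sigma> - h"
    unfolding power2_eq_square[symmetric] power2_norm_eq_inner
    by (simp add: A_def h_def inner_diff_right)
  ultimately have "norm A * norm A \<le> B * norm A"
    by simp
  then have "norm A \<le> B"
    using B0 by (cases "norm A = 0") (auto simp: mult_le_cancel_right)
  then have "ereal (hs_norm (\<sigma> - \<tau>)) \<le> ereal B"
    by (simp add: hs_norm_eq_norm A_def)
  then show "(INF \<tau> \<in> SEP2. ereal (hs_norm (\<sigma> - \<tau>))) \<le> ereal (min (sqrt (real CARD('d) - 1) / (real N - 1)) (8 / sqrt (real N - 1)))"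
    unfolding B_def by (rule INF_lower2[OF \<tau>])
qed

end
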